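(* Let $\mathcal{F}:[0,1]\to\mathbb{R}$ be defined as follows. For natural numbers $q\ge 1$ and $p\in\{0,1,\dots,q-1\}$ let \[ \beta_{p,q}(x)=\begin{cases}0 & \text{if } 0\le x\le \frac{p}{q},\\ 2^q\left(x-\frac{p}{q}\right) & \text{if } \frac{p}{q}\le x\le \frac{p+2^{-q}}{q},\\ \frac{1}{q} & \text{if } \frac{p+2^{-q}}{q}\le x\le 1,\end{cases} \] let $\alpha_q(x)=\sum_{p=0}^{q-1}\beta_{p,q}(x)$, and let $\mathcal{F}(x)=\sum_{q=1}^{\infty}\frac{1}{q^2}\alpha_q(x)$. Then $\mathcal{F}$ is an exponential time computable real function on $[0,1]$.
   Context: Let $\mathbf{D}$ denote the set of dyadic rationals. A function $\phi:\mathbb{N}\to\mathbf{D}$ binary converges to $x\in\mathbb{R}$ if $|\phi(n)-x|\le 2^{-n}$ for all $n$; $CF_x$ is the set of such functions. A real function $f:[a,b]\to\mathbb{R}$ is exponential time computable on $[a,b]$ if there is a function-oracle Turing machine $M$ and a polynomial $p$ such that for every $x\in[a,b]$ and every oracle $\phi\in CF_x$, the function $n\mapsto M^{\phi}(n)$ belongs to $CF_{f(x)}$ and the running time of $M^\phi$ on input $n$ is at most $2^{p(n)}$; each oracle query costs one time unit. *)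

theory Defs
  imports Complex_Main "HOL-Computational_Algebra.Polynomial"
begin

definition dyadic_rationals :: "real set" where
  "dyadic_rationals = {real_of_int a / 2 ^ k | a k. True}"

definition binary_converges :: "(nat \<Rightarrow> real) \<Rightarrow> real \<Rightarrow> bool" where
  "binary_converges \<phi> x \<longleftrightarrow> (\<forall>n. \<bar>\<phi> n - x\<bar> \<le> 1 / 2 ^ n)"

definition CF :: "real \<Rightarrow> (nat \<Rightarrow> real) set" where
  "CF x = {\<phi>. range \<phi> \<subseteq> dyadic_rationals \<and> binary_converges \<phi> x}"

text \<open>Tape symbols. A machine uses only finitely many of the auxiliary symbols.\<close>

datatype symbol = Blank | Bit bool | Point | Minus | Aux nat

text \<open>
  Dyadic rationals are written as signed fixed-point binary strings, most significant bit first.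
  The integer part must be present; the fractional part may be empty.
\<close>

definition represents :: "symbol list \<Rightarrow> real \<Rightarrow> bool" where
  "represents w d \<longleftrightarrow> (\<exists>neg bs fs. bs \<noteq> [] \<and>
     w = (if neg then [Minus] else []) @ map Bit bs @ [Point] @ map Bit fs \<and>
     d = (if neg then - 1 else 1) * (horner_sum of_bool 2 (rev (bs @ fs)) / 2 ^ length fs))"

fun nat_bits :: "nat \<Rightarrow> bool list" where
  "nat_bits n = (if n < 2 then [odd n] else nat_bits (n div 2) @ [odd n])"

declare nat_bits.simps [simp del]

definition dyadic_prec :: "real \<Rightarrow> nat" where
  "dyadic_prec d = (LEAST k. d * 2 ^ k \<in> \<int>)"

text \<open>
  The canonical string of a dyadic rational: no leading zeros in the integer part (which is the
  single digit 0 if it vanishes), no trailing zeros in the fractional part, no sign on 0.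
  This is the form in which an oracle delivers its answers.
\<close>

definition dyadic_word :: "real \<Rightarrow> symbol list" where
  "dyadic_word d =
     (if d < 0 then [Minus] else []) @ map Bit (nat_bits (nat \<lfloor>\<bar>d\<bar>\<rfloor>)) @ [Point] @
     map (\<lambda>i. Bit (odd \<lfloor>\<bar>d\<bar> * 2 ^ Suc i\<rfloor>)) [0..<dyadic_prec d]"

lemma horner_sum_nat_bits: "horner_sum of_bool 2 (rev (nat_bits n)) = real n"
proof (induction n rule: nat_bits.induct)
  case (1 n)
  show ?case
  proof (cases "n < 2")
    case True
    then have "n = 0 \<or> n = 1" by auto
    with True show ?thesis by (subst nat_bits.simps) auto
  next
    case False
    have "n = 2 * (n div 2) + of_bool (odd n)" by (cases "even n") (auto elim!: evenE oddE)
    then have "real n = 2 * real (n div 2) + of_bool (odd n)"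
      by (metis of_nat_add of_nat_mult of_nat_numeral of_nat_of_bool)
    with False 1 show ?thesis by (subst nat_bits.simps) simp
  qed
qed

lemma horner_sum_fixed_point:
  fixes y :: real
  assumes "0 \<le> y"
  shows "horner_sum of_bool 2
           (rev (nat_bits (nat \<lfloor>y\<rfloor>) @ map (\<lambda>i. odd \<lfloor>y * 2 ^ Suc i\<rfloor>) [0..<k])) =
         real_of_int \<lfloor>y * 2 ^ k\<rfloor>"
proof (induction k)
  case 0
  show ?case using assms horner_sum_nat_bits[of "nat \<lfloor>y\<rfloor>"] by simp
next
  case (Suc k)
  define m where "m = \<lfloor>y * 2 ^ Suc k\<rfloor>"
  have "m div 2 = \<lfloor>y * 2 ^ k\<rfloor>"
    using floor_divide_real_eq_div[of 2 "y * 2 ^ Suc k"] by (simp add: m_def)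
  then have "2 * real_of_int \<lfloor>y * 2 ^ k\<rfloor> = 2 * real_of_int (m div 2)" by simp
  also have "\<dots> + of_bool (odd m) = real_of_int m"
    by (cases "even m") (auto elim!: evenE oddE)
  finally show ?case using Suc by (simp add: m_def[symmetric] del: power_Suc)
qed

lemma represents_dyadic_word:
  assumes "d \<in> dyadic_rationals"
  shows "represents (dyadic_word d) d"
proof -
  obtain a k where "d = real_of_int a / 2 ^ k" using assms by (auto simp: dyadic_rationals_def)
  then have "d * 2 ^ k \<in> \<int>" by simp
  then have "d * 2 ^ dyadic_prec d \<in> \<int>" unfolding dyadic_prec_def by (rule LeastI)
  then have "\<bar>d * 2 ^ dyadic_prec d\<bar> \<in> \<int>" by (rule Ints_abs)
  then have "real_of_int \<lfloor>\<bar>d\<bar> * 2 ^ dyadic_prec d\<rfloor> = \<bar>d\<bar> * 2 ^ dyadic_prec d"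
    by (simp add: abs_mult)
  moreover define bs where "bs = nat_bits (nat \<lfloor>\<bar>d\<bar>\<rfloor>)"
  moreover define fs where "fs = map (\<lambda>i. odd \<lfloor>\<bar>d\<bar> * 2 ^ Suc i\<rfloor>) [0..<dyadic_prec d]"
  ultimately have "horner_sum of_bool 2 (rev (bs @ fs)) = \<bar>d\<bar> * 2 ^ length fs"
    using horner_sum_fixed_point[of "\<bar>d\<bar>" "dyadic_prec d"] by simp
  then have "d = (if d < 0 then - 1 else 1) *
      (horner_sum of_bool 2 (rev (bs @ fs)) / 2 ^ length fs)"
    by (simp del: rev_append)
  moreover have "bs \<noteq> []" unfolding bs_def by (subst nat_bits.simps) simp
  moreover have "dyadic_word d = (if d < 0 then [Minus] else []) @ map Bit bs @ [Point] @ map Bit fs"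
    by (simp add: dyadic_word_def bs_def fs_def)
  ultimately show ?thesis unfolding represents_def by blast
qed

text \<open>
  Deterministic multitape function-oracle Turing machines with two-way infinite tapes.
  A tape is given by its contents and its head position. Tape 0 is the input tape, tape 1 the
  query tape, tape 2 the output tape; all further tapes are work tapes.
\<close>

type_synonym tape = "(int \<Rightarrow> symbol) \<times> int"

datatype direction = Left | Stay | Right

record otm =
  num_tapes :: nat
  states :: "nat set"
  alphabet :: "symbol set"
  start_state :: nat
  halt_state :: nat
  query_state :: nat
  answer_state :: nat
  delta :: "nat \<Rightarrow> symbol list \<Rightarrow> nat \<times> (symbol \<times> direction) list"

definition wf_otm :: "otm \<Rightarrow> bool" where
  "wf_otm M \<longleftrightarrow>
     3 \<le> num_tapes M \<and> finite (states M) \<and> finite (alphabet M) \<and>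
     {start_state M, halt_state M, query_state M, answer_state M} \<subseteq> states M \<and>
     distinct [halt_state M, query_state M, answer_state M] \<and>
     {Blank, Bit False, Bit True, Point, Minus} \<subseteq> alphabet M \<and>
     (\<forall>q\<in>states M. \<forall>ss. length ss = num_tapes M \<and> set ss \<subseteq> alphabet M \<longrightarrow>
        (case delta M q ss of (q', acts) \<Rightarrow>
           q' \<in> states M \<and> length acts = num_tapes M \<and> fst ` set acts \<subseteq> alphabet M))"

definition word_tape :: "symbol list \<Rightarrow> tape" where
  "word_tape w = (\<lambda>i. if 0 \<le> i \<and> i < int (length w) then w ! nat i else Blank, 0)"

fun read_tape :: "tape \<Rightarrow> symbol" where
  "read_tape (c, h) = c h"

fun move_head :: "direction \<Rightarrow> int \<Rightarrow> int" where
  "move_head Left h = h - 1"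
| "move_head Stay h = h"
| "move_head Right h = h + 1"

fun act_tape :: "symbol \<times> direction \<Rightarrow> tape \<Rightarrow> tape" where
  "act_tape (s, d) (c, h) = (c(h := s), move_head d h)"

text \<open>
  Arguments of oracle queries are written in unary: the argument is the length of the block of
  ones that starts at cell 0.
\<close>

definition query_arg :: "tape \<Rightarrow> nat" where
  "query_arg t = (LEAST i. fst t (int i) \<noteq> Bit True)"

text \<open>
  In the query state the machine makes one step that replaces the contents of the query tape by
  the oracle's answer, moves the head of that tape to cell 0 and enters the answer state.
\<close>

fun otm_step :: "otm \<Rightarrow> (nat \<Rightarrow> real) \<Rightarrow> nat \<times> tape list \<Rightarrow> nat \<times> tape list" where
  "otm_step M \<phi> (q, ts) =
     (if q = halt_state M then (q, ts)
      else if q = query_state M then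
        (answer_state M, ts[1 := word_tape (dyadic_word (\<phi> (query_arg (ts ! 1))))])
      else (case delta M q (map read_tape ts) of (q', acts) \<Rightarrow> (q', map2 act_tape acts ts)))"

definition otm_init :: "otm \<Rightarrow> nat \<Rightarrow> nat \<times> tape list" where
  "otm_init M n =
     (start_state M,
      word_tape (replicate n (Bit True)) # replicate (num_tapes M - 1) (word_tape []))"

definition tape_output :: "tape \<Rightarrow> symbol list \<Rightarrow> bool" where
  "tape_output t w \<longleftrightarrow>
     Blank \<notin> set w \<and> (\<forall>i<length w. fst t (int i) = w ! i) \<and> fst t (int (length w)) = Blank"

text \<open>
  With oracle \<open>\<phi>\<close> and input \<open>n\<close> in unary, \<open>M\<close> halts within \<open>t\<close> steps with output \<open>d\<close>;
  halting configurations are fixed points of the step function. At most one \<open>d\<close> qualifies,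
  since the machine is deterministic and a string represents at most one number; so \<open>\<psi>\<close> in the
  definition of computability below is the function computed by \<open>M\<close> with oracle \<open>\<phi>\<close>.
\<close>

definition otm_outputs_within :: "otm \<Rightarrow> (nat \<Rightarrow> real) \<Rightarrow> nat \<Rightarrow> nat \<Rightarrow> real \<Rightarrow> bool" where
  "otm_outputs_within M \<phi> n t d \<longleftrightarrow>
     (case (otm_step M \<phi> ^^ t) (otm_init M n) of (q, ts) \<Rightarrow>
        q = halt_state M \<and> (\<exists>w. tape_output (ts ! 2) w \<and> represents w d))"

definition exp_time_computable_on :: "real \<Rightarrow> real \<Rightarrow> (real \<Rightarrow> real) \<Rightarrow> bool" where
  "exp_time_computable_on a b f \<longleftrightarrow>
     (\<exists>M (p :: nat poly). wf_otm M \<and>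
        (\<forall>x\<in>{a..b}. \<forall>\<phi>\<in>CF x. \<exists>\<psi>\<in>CF (f x).
           \<forall>n. otm_outputs_within M \<phi> n (2 ^ poly p n) (\<psi> n)))"

definition beta_fn :: "nat \<Rightarrow> nat \<Rightarrow> real \<Rightarrow> real" where
  "beta_fn p q x =
     (if x \<le> real p / real q then 0
      else if x \<le> (real p + 1 / 2 ^ q) / real q then 2 ^ q * (x - real p / real q)
      else 1 / real q)"

definition alpha_fn :: "nat \<Rightarrow> real \<Rightarrow> real" where
  "alpha_fn q x = (\<Sum>p<q. beta_fn p q x)"

text \<open>The summation index is shifted by one: the sum ranges over all \<open>q \<ge> 1\<close>.\<close>

definition calF :: "real \<Rightarrow> real" where
  "calF x = (\<Sum>q. 1 / real (Suc q) ^ 2 * alpha_fn (Suc q) x)"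

end

(*
  For q >= 1 the function beta_{p,q} is 1/q times the clipping of 2^q (q x - p) to [0,1], so
  F(x) is the sum over q of q^(-3) times the sum over p < q of these clippings, and dropping all
  q > N costs at most 1/N.  Take N = 2^(n+1), m = 2n+5, C = 2^m and one oracle query with the
  exponentially large argument C.  If r is the truncation of 2^i (q x - p) that uses i binary
  digits of x, the next digit b replaces r by 2r + q b, i.e. R = r + q by 2R - q (1 - b).
  Values of R below 0 or above C can only move further outwards, so R may be clamped to [0,C];
  after q + m digits R - q approximates C times the clipping up to 3q.  All numbers that occur
  are at most exponential in n, so they can be stored in unary as head positions, and a small
  structured language on such counters is compiled to oracle machines.
*)
theory Submission
  imports Defs
begin

text \<open>The slope \<open>2 ^ q\<close>, with \<open>q\<close> up to \<open>2 ^ Suc n\<close>, is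
  doubly exponential, so neither it nor the first \<open>q + m\<close> digits of the answer read as
  one integer fit into a unary counter of exponential size. The answer therefore stays on the query
  tape and is scanned once for every pair of p and q, while clamping bounds the one quantity that
  would otherwise explode. The shift by q accounts for the digits not yet read: they keep
  \<open>2 ^ i * (q * x - p)\<close> below r + q. The outcome 0 is thus certain as soon as r \<le>
  -q, and the shift moves this threshold to 0, where truncated subtraction of naturals performs the
  clamp. An oracle answer can be arbitrarily long, but only the required digits are visited, so its
  length does not enter the running time. The query argument must be at least N + m; C is chosen
  because a counter already holds it.\<close>

declare otm_step.simps [simp del]

subsection \<open>Programs on counters and their compilation\<close>

text \<open>
  While a level \<open>q\<close> is processed, \<open>Den\<close> holds \<open>q\<close>, \<open>Off\<close> holds \<open>q - p\<close>, \<open>Rem\<close> the clamped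
  residue and \<open>Slack\<close> the difference to \<open>C\<close>, so that saturation at \<open>C\<close> comes for free.
\<close>

datatype reg = Den | Off | Rem | Slack | Twice | Acc | Quo | Tot | Unit | Prec | Cnt | Done | Spare

datatype instr_op = Inc reg | Dec reg | Tr reg reg | Mv nat direction | Wr nat symbol direction

datatype test = NZ reg | Rd nat symbol

datatype com = Skip | Op instr_op | Seq com com (infixr ";;" 60) | While test com | Cond test com com

text \<open>
  Tapes 0, 1 and 2 are kept as they are, the work tapes as the counters they represent; only the
  first three values of the tape component are meaningful, whence \<open>mod 3\<close> below.
\<close>

type_synonym store = "(nat \<Rightarrow> tape) \<times> (reg \<Rightarrow> nat)"

fun op_sem :: "instr_op \<Rightarrow> store \<Rightarrow> store" where
  "op_sem (Inc i) (\<rho>, f) = (\<rho>, f(i := Suc (f i)))"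
| "op_sem (Dec i) (\<rho>, f) = (\<rho>, f(i := f i - 1))"
| "op_sem (Tr i j) (\<rho>, f) = (\<rho>, if f i = 0 then f else f(j := Suc (f j), i := f i - 1))"
| "op_sem (Mv k d) (\<rho>, f) = (\<rho>(k := act_tape (read_tape (\<rho> k), d) (\<rho> k)), f)"
| "op_sem (Wr k s d) (\<rho>, f) = (\<rho>(k := act_tape (s, d) (\<rho> k)), f)"

fun test_sem :: "test \<Rightarrow> store \<Rightarrow> bool" where
  "test_sem (NZ i) (\<rho>, f) = (f i \<noteq> 0)"
| "test_sem (Rd k s) (\<rho>, f) = (read_tape (\<rho> (k mod 3)) = s)"

text \<open>The costs are the step counts of the compiled code: a completed loop round pays for its
  branch and its back jump, a \<open>Cond\<close> for its branch and, in the first alternative, for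
  the jump over the second.\<close>

inductive exec :: "com \<Rightarrow> store \<Rightarrow> nat \<Rightarrow> store \<Rightarrow> bool" where
  exec_Skip: "exec Skip s 0 s"
| exec_Op: "exec (Op a) s 1 (op_sem a s)"
| exec_Seq: "exec c s t s' \<Longrightarrow> exec d s' u s'' \<Longrightarrow> exec (Seq c d) s (t + u) s''"
| exec_While_False: "\<not> test_sem b s \<Longrightarrow> exec (While b c) s 1 s"
| exec_While_True: "test_sem b s \<Longrightarrow> exec c s t s' \<Longrightarrow> exec (While b c) s' u s'' \<Longrightarrow>
    exec (While b c) s (2 + t + u) s''"
| exec_Cond_True: "test_sem b s \<Longrightarrow> exec c s t s' \<Longrightarrow> exec (Cond b c d) s (t + 2) s'"
| exec_Cond_False: "\<not> test_sem b s \<Longrightarrow> exec d s t s' \<Longrightarrow> exec (Cond b c d) s (t + 1) s'"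

datatype instr = IOp instr_op | IBranch test nat | IGoto nat | IMark | IStop

fun compile :: "com \<Rightarrow> nat \<Rightarrow> instr list" where
  "compile Skip p = []"
| "compile (Op a) p = [IOp a]"
| "compile (Seq c d) p = compile c p @ compile d (p + length (compile c p))"
| "compile (While b c) p =
     (let cs = compile c (Suc p) in IBranch b (p + length cs + 2) # cs @ [IGoto p])"
| "compile (Cond b c d) p =
     (let cs = compile c (Suc p); ds = compile d (p + length cs + 2)
      in IBranch b (p + length cs + 2) # cs @ IGoto (p + length cs + 2 + length ds) # ds)"

text \<open>The value of a counter is its head position; the mark at cell 0 is the zero test.\<close>

definition counter_tape :: "nat \<Rightarrow> tape" where
  "counter_tape v = (\<lambda>i. if i = 0 then Point else Blank, int v)"

definition regs :: "reg list" where
  "regs = [Den, Off, Rem, Slack, Twice, Acc, Quo, Tot, Unit, Prec, Cnt, Done, Spare]"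

fun reg_tape :: "reg \<Rightarrow> nat" where
  "reg_tape Den = 3" | "reg_tape Off = 4" | "reg_tape Rem = 5" | "reg_tape Slack = 6"
| "reg_tape Twice = 7" | "reg_tape Acc = 8" | "reg_tape Quo = 9" | "reg_tape Tot = 10"
| "reg_tape Unit = 11" | "reg_tape Prec = 12" | "reg_tape Cnt = 13" | "reg_tape Done = 14"
| "reg_tape Spare = 15"

definition tapes_of :: "store \<Rightarrow> tape list" where
  "tapes_of s = map (fst s) [0, 1, 2] @ map (\<lambda>r. counter_tape (snd s r)) regs"

fun raw_act :: "instr_op \<Rightarrow> symbol list \<Rightarrow> nat \<Rightarrow> symbol \<times> direction" where
  "raw_act (Mv k' d) ss k = (ss ! k, if k = k' then d else Stay)"
| "raw_act (Wr k' s d) ss k = (if k = k' then (s, d) else (ss ! k, Stay))"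
| "raw_act _ ss k = (ss ! k, Stay)"

fun reg_dir :: "instr_op \<Rightarrow> symbol list \<Rightarrow> reg \<Rightarrow> direction" where
  "reg_dir (Inc i) ss r = (if r = i then Right else Stay)"
| "reg_dir (Dec i) ss r = (if r = i \<and> ss ! reg_tape i \<noteq> Point then Left else Stay)"
| "reg_dir (Tr i j) ss r =
     (if ss ! reg_tape i = Point then Stay else if r = i then Left
      else if r = j then Right else Stay)"
| "reg_dir _ ss r = Stay"

definition op_acts :: "instr_op \<Rightarrow> symbol list \<Rightarrow> (symbol \<times> direction) list" where
  "op_acts a ss = map (raw_act a ss) [0, 1, 2] @ map (\<lambda>r. (ss ! reg_tape r, reg_dir a ss r)) regs"

definition idle_acts :: "symbol list \<Rightarrow> (symbol \<times> direction) list" where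
  "idle_acts ss = map (\<lambda>s. (s, Stay)) ss"

text \<open>The work tapes start blank, without the mark at cell 0; this action turns each of them
  into the counter 0.\<close>

definition mark_acts :: "symbol list \<Rightarrow> (symbol \<times> direction) list" where
  "mark_acts ss = map (\<lambda>k. (ss ! k, Stay)) [0, 1, 2] @ map (\<lambda>r. (Point, Stay)) regs"

fun test_syms :: "test \<Rightarrow> symbol list \<Rightarrow> bool" where
  "test_syms (NZ i) ss = (ss ! reg_tape i \<noteq> Point)"
| "test_syms (Rd k s) ss = (ss ! (k mod 3) = s)"

fun instr_delta :: "instr \<Rightarrow> nat \<Rightarrow> symbol list \<Rightarrow> nat \<times> (symbol \<times> direction) list" where
  "instr_delta (IOp a) q ss = (Suc q, op_acts a ss)"
| "instr_delta (IBranch b p) q ss = (if test_syms b ss then Suc q else p, idle_acts ss)"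
| "instr_delta (IGoto p) q ss = (p, idle_acts ss)"
| "instr_delta IMark q ss = (Suc q, mark_acts ss)"
| "instr_delta IStop q ss = (q, idle_acts ss)"

definition base_alphabet :: "symbol set" where
  "base_alphabet = {Blank, Bit False, Bit True, Point, Minus}"

text \<open>The addresses of the two \<open>IStop\<close> are the query state and the halt state,
  where \<open>otm_step\<close> never consults \<open>delta\<close>. The \<open>IGoto\<close>
  between the programs is the answer state; it keeps the three special states distinct even if
  \<open>d\<close> compiles to nothing.\<close>

definition oracle_code :: "com \<Rightarrow> com \<Rightarrow> instr list" where
  "oracle_code c d =
     (let cs = IMark # compile c 1 @ [IStop, IGoto (length (compile c 1) + 3)]
      in cs @ compile d (length cs) @ [IStop])"

definition machine :: "com \<Rightarrow> com \<Rightarrow> otm" where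
  "machine c d =
     \<lparr> num_tapes = 16, states = {..<length (oracle_code c d)}, alphabet = base_alphabet,
       start_state = 0, halt_state = length (oracle_code c d) - 1,
       query_state = length (compile c 1) + 1, answer_state = length (compile c 1) + 2,
       delta = (\<lambda>q ss. instr_delta (oracle_code c d ! q) q ss) \<rparr>"

fun com_ok :: "com \<Rightarrow> bool" where
  "com_ok (Op (Wr k s d)) = (s \<in> base_alphabet)"
| "com_ok (Op _) = True"
| "com_ok Skip = True"
| "com_ok (Seq c d) = (com_ok c \<and> com_ok d)"
| "com_ok (While b c) = com_ok c"
| "com_ok (Cond b c d) = (com_ok c \<and> com_ok d)"

fun instr_ok :: "nat \<Rightarrow> instr \<Rightarrow> bool" where
  "instr_ok l (IOp (Wr k s d)) = (s \<in> base_alphabet)"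
| "instr_ok l (IBranch b p) = (p < l)"
| "instr_ok l (IGoto p) = (p < l)"
| "instr_ok l _ = True"

section \<open>Well-formedness of the compiled machine\<close>

lemma length_regs [simp]: "length regs = 13"
  by (simp add: regs_def)

lemma reg_tape_less: "reg_tape r < 16"
  by (cases r) auto

lemma nth_reg_tape: "(map g [0, 1, 2] @ map h regs) ! reg_tape r = h r"
  by (cases r) (simp_all add: regs_def)

text \<open>The bound by \<open>l\<close> is strict because a loop at the end of the fragment exits
  to the address just behind it, which must still be a state.\<close>

lemma compile_ok:
  "com_ok c \<Longrightarrow> p + length (compile c p) < l \<Longrightarrow> \<forall>i\<in>set (compile c p). instr_ok l i"
proof (induction c arbitrary: p)
  case (Op a)
  then show ?case by (cases a) auto
next
  case (Seq c d)
  then show ?case using Seq.IH(1)[of p] Seq.IH(2)[of "p + length (compile c p)"] by auto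
next
  case (While b c)
  then show ?case using While.IH[of "Suc p"] by (auto simp: Let_def)
next
  case (Cond b c d)
  then show ?case
    using Cond.IH(1)[of "Suc p"] Cond.IH(2)[of "p + length (compile c (Suc p)) + 2"]
    by (auto simp: Let_def)
qed auto

lemma op_acts_wf:
  assumes "length ss = 16" "set ss \<subseteq> base_alphabet" "com_ok (Op a)"
  shows "length (op_acts a ss) = 16" "fst ` set (op_acts a ss) \<subseteq> base_alphabet"
proof -
  have *: "ss ! k \<in> base_alphabet" if "k < 16" for k
    using assms that by (metis nth_mem subsetD)
  have "fst (raw_act a ss k) \<in> base_alphabet" if "k < 3" for k
    using assms(3) *[of k] that by (cases a) auto
  then show "fst ` set (op_acts a ss) \<subseteq> base_alphabet"
    using * reg_tape_less by (auto simp: op_acts_def)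
qed (simp add: op_acts_def)

lemma wf_machine:
  assumes "com_ok c" "com_ok d"
  shows "wf_otm (machine c d)"
proof -
  define code where "code = oracle_code c d"
  define l where "l = length code"
  have l: "length (compile c 1) + 3 < l"
    by (simp add: l_def code_def oracle_code_def Let_def)
  \<comment> \<open>Passing to the next address could leave the set of states only from the last
    one, and that holds \<open>IStop\<close>.\<close>
  have ok: "instr_ok l (code ! q)" "code ! q = IStop \<or> (\<exists>p. code ! q = IGoto p) \<or> Suc q < l"
    if "q < l" for q
  proof -
    have "\<forall>i\<in>set code. instr_ok l i"
      using compile_ok[OF assms(1), of 1 l] compile_ok[OF assms(2), of "length (compile c 1) + 3" l]
      by (auto simp: l_def code_def oracle_code_def Let_def eval_nat_numeral)
    then show "instr_ok l (code ! q)" using that by (simp add: l_def)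
    have "code ! (l - 1) = IStop"
      by (simp add: l_def code_def oracle_code_def Let_def nth_append)
    then show "code ! q = IStop \<or> (\<exists>p. code ! q = IGoto p) \<or> Suc q < l"
      using that by (cases "Suc q = l") auto
  qed
  have "case instr_delta (code ! q) q ss of (q', acts) \<Rightarrow>
      q' < l \<and> length acts = 16 \<and> fst ` set acts \<subseteq> base_alphabet"
    if q: "q < l" and ss: "length ss = 16" "set ss \<subseteq> base_alphabet" for q ss
  proof (cases "code ! q")
    case (IOp a)
    then have "com_ok (Op a)" using ok(1)[OF q] by (cases a) auto
    then show ?thesis using IOp ok(2)[OF q] op_acts_wf[OF ss] by simp
  next
    case IMark
    have "ss ! k \<in> base_alphabet" if "k < 16" for k
      using ss that by (metis nth_mem subsetD)
    then show ?thesis using IMark ok(2)[OF q]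
      by (auto simp: mark_acts_def base_alphabet_def)
  qed (use ok[OF q] q ss in \<open>auto simp: idle_acts_def image_image\<close>)
  then show ?thesis
    using l by (auto simp: wf_otm_def machine_def base_alphabet_def code_def l_def)
qed

section \<open>Simulation of the counter language by machine steps\<close>

lemma act_tape_read_Stay [simp]: "act_tape (read_tape t, Stay) t = t"
  by (cases t) auto

lemma read_counter_tape: "read_tape (counter_tape v) = Point \<longleftrightarrow> v = 0"
  by (simp add: counter_tape_def)

lemma act_counter_tape:
  "act_tape (read_tape (counter_tape v), Right) (counter_tape v) = counter_tape (Suc v)"
  "v > 0 \<Longrightarrow> act_tape (read_tape (counter_tape v), Left) (counter_tape v) = counter_tape (v - 1)"
  by (auto simp: counter_tape_def fun_eq_iff)

lemma read_tapes_of: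
  "map read_tape (tapes_of s) ! reg_tape r = read_tape (counter_tape (snd s r))"
  "k < 3 \<Longrightarrow> map read_tape (tapes_of s) ! k = read_tape (fst s k)"
proof -
  show "map read_tape (tapes_of s) ! reg_tape r = read_tape (counter_tape (snd s r))"
    using nth_reg_tape[of "read_tape \<circ> fst s" "\<lambda>r. read_tape (counter_tape (snd s r))" r]
    by (simp add: tapes_of_def o_def)
  show "map read_tape (tapes_of s) ! k = read_tape (fst s k)" if "k < 3"
  proof -
    have "k = 0 \<or> k = 1 \<or> k = 2" using that by auto
    then show ?thesis by (auto simp: tapes_of_def)
  qed
qed

lemma test_syms_tapes_of: "test_syms b (map read_tape (tapes_of s)) = test_sem b s"
  by (cases s; cases b) (simp_all only: test_syms.simps test_sem.simps read_tapes_of read_counter_tape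
      fst_conv snd_conv mod_less_divisor zero_less_numeral)

lemma op_acts_tapes_of:
  "map2 act_tape (op_acts a (map read_tape (tapes_of s))) (tapes_of s) = tapes_of (op_sem a s)"
proof -
  define ss where "ss = map read_tape (tapes_of s)"
  obtain \<rho> f where s: "s = (\<rho>, f)" by (cases s)
  have raw: "act_tape (raw_act a ss k) (\<rho> k) = fst (op_sem a s) k" if "k < 3" for k
    using that by (cases a) (auto simp: ss_def s read_tapes_of)
  have reg: "act_tape (ss ! reg_tape r, reg_dir a ss r) (counter_tape (f r)) =
      counter_tape (snd (op_sem a s) r)" for r
    by (cases a) (auto simp: ss_def s read_tapes_of read_counter_tape act_counter_tape)
  show ?thesis
    unfolding ss_def[symmetric] using raw reg
    by (simp add: op_acts_def tapes_of_def s zip_map_map zip_same_conv_map)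
qed

lemma idle_acts_tapes: "map2 act_tape (idle_acts (map read_tape ts)) ts = ts"
  by (induction ts) (auto simp: idle_acts_def)

lemma machine_step:
  assumes "q \<noteq> halt_state (machine c d)" "q \<noteq> query_state (machine c d)"
  shows "otm_step (machine c d) \<phi> (q, ts) =
    (case instr_delta (oracle_code c d ! q) q (map read_tape ts) of (q', acts) \<Rightarrow>
       (q', map2 act_tape acts ts))"
  using assms by (simp add: otm_step.simps machine_def)

lemma funpow_add_apply: "(g ^^ (m + n)) x = (g ^^ n) ((g ^^ m) x)"
  by (simp add: add.commute[of m] funpow_add)

text \<open>Jump targets are absolute, so the surrounding code \<open>pre\<close> and
  \<open>post\<close> is generalized in the induction on the execution. The condition on the states
  covers only the addresses inside the fragment: the exit address may be the query or the halt
  state, which is how the two programs are joined.\<close>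

lemma compile_correct:
  assumes "exec e s t s'"
    and "oracle_code c d = pre @ compile e (length pre) @ post"
    and "\<forall>q. length pre \<le> q \<and> q < length pre + length (compile e (length pre)) \<longrightarrow>
           q \<noteq> halt_state (machine c d) \<and> q \<noteq> query_state (machine c d)"
  shows "(otm_step (machine c d) \<phi> ^^ t) (length pre, tapes_of s) =
    (length pre + length (compile e (length pre)), tapes_of s')"
  using assms
proof (induction arbitrary: pre post rule: exec.induct)
  case (exec_Skip s)
  then show ?case by simp
next
  case (exec_Op a s)
  then show ?case by (simp add: machine_step op_acts_tapes_of)
next
  case (exec_Seq e s t s' e' u s'')
  let ?l = "length (compile e (length pre))"
  have "(otm_step (machine c d) \<phi> ^^ t) (length pre, tapes_of s) = (length pre + ?l, tapes_of s')"
    using exec_Seq.prems by (intro exec_Seq.IH(1)[where post = "compile e' (length pre + ?l) @ post"]) auto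
  moreover have "(otm_step (machine c d) \<phi> ^^ u) (length pre + ?l, tapes_of s') =
      (length pre + ?l + length (compile e' (length pre + ?l)), tapes_of s'')"
    using exec_Seq.IH(2)[of "pre @ compile e (length pre)" post] exec_Seq.prems by simp
  ultimately show ?case by (simp add: funpow_add_apply)
next
  case (exec_While_False b s e)
  then show ?case
    by (simp add: machine_step test_syms_tapes_of idle_acts_tapes Let_def)
next
  case (exec_While_True b s e t s' u s'')
  let ?p = "length pre" let ?cs = "compile e (Suc ?p)" let ?step = "otm_step (machine c d) \<phi>"
  have 1: "?step (?p, tapes_of s) = (Suc ?p, tapes_of s)"
    using exec_While_True.hyps(1) exec_While_True.prems
    by (simp add: machine_step test_syms_tapes_of idle_acts_tapes Let_def)
  have 2: "(?step ^^ t) (Suc ?p, tapes_of s) = (Suc ?p + length ?cs, tapes_of s')"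
    using exec_While_True.IH(1)[of "pre @ [IBranch b (?p + length ?cs + 2)]" "IGoto ?p # post"]
      exec_While_True.prems by (simp add: Let_def)
  have 3: "?step (Suc ?p + length ?cs, tapes_of s') = (?p, tapes_of s')"
    using exec_While_True.prems by (simp add: machine_step idle_acts_tapes Let_def nth_append)
  have 4: "(?step ^^ u) (?p, tapes_of s') = (?p + length (compile (While b e) ?p), tapes_of s'')"
    using exec_While_True.IH(2) exec_While_True.prems by blast
  have "2 + t + u = 1 + t + 1 + u" by simp
  then show ?case by (simp only: funpow_add_apply 1 2 3 4 One_nat_def funpow.simps o_apply id_apply)
next
  case (exec_Cond_True b s e t s' e')
  let ?p = "length pre" let ?cs = "compile e (Suc ?p)" let ?step = "otm_step (machine c d) \<phi>"
  let ?ds = "compile e' (?p + length ?cs + 2)"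
  have 1: "?step (?p, tapes_of s) = (Suc ?p, tapes_of s)"
    using exec_Cond_True.hyps(1) exec_Cond_True.prems
    by (simp add: machine_step test_syms_tapes_of idle_acts_tapes Let_def)
  have 2: "(?step ^^ t) (Suc ?p, tapes_of s) = (Suc ?p + length ?cs, tapes_of s')"
    using exec_Cond_True.IH[of "pre @ [IBranch b (?p + length ?cs + 2)]"
        "IGoto (?p + length ?cs + 2 + length ?ds) # ?ds @ post"]
      exec_Cond_True.prems by (simp add: Let_def)
  have 3: "?step (Suc ?p + length ?cs, tapes_of s') = (?p + length (compile (Cond b e e') ?p), tapes_of s')"
    using exec_Cond_True.prems by (simp add: machine_step idle_acts_tapes Let_def nth_append)
  have "t + 2 = 1 + t + 1" by simp
  then show ?case by (simp only: funpow_add_apply 1 2 3 One_nat_def funpow.simps o_apply id_apply)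
next
  case (exec_Cond_False b s e' t s' e)
  let ?p = "length pre" let ?cs = "compile e (Suc ?p)" let ?step = "otm_step (machine c d) \<phi>"
  let ?ds = "compile e' (?p + length ?cs + 2)"
  have 1: "?step (?p, tapes_of s) = (?p + length ?cs + 2, tapes_of s)"
    using exec_Cond_False.hyps(1) exec_Cond_False.prems
    by (simp add: machine_step test_syms_tapes_of idle_acts_tapes Let_def)
  have 2: "(?step ^^ t) (?p + length ?cs + 2, tapes_of s) =
      (?p + length (compile (Cond b e e') ?p), tapes_of s')"
    using exec_Cond_False.IH[of "pre @ IBranch b (?p + length ?cs + 2) # ?cs @
        [IGoto (?p + length ?cs + 2 + length ?ds)]" post]
      exec_Cond_False.prems by (simp add: Let_def)
  have "t + 1 = 1 + t" by simp
  then show ?case by (simp only: funpow_add_apply 1 2 One_nat_def funpow.simps o_apply id_apply)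
qed

definition input_store :: "nat \<Rightarrow> store" where
  "input_store n = (\<lambda>k. word_tape (if k = 0 then replicate n (Bit True) else []), \<lambda>r. 0)"

definition answer_store :: "(nat \<Rightarrow> real) \<Rightarrow> store \<Rightarrow> store" where
  "answer_store \<phi> s =
     ((fst s)(1 := word_tape (dyadic_word (\<phi> (query_arg (fst s 1))))), snd s)"

lemma funpow_one: "((g :: 'a \<Rightarrow> 'a) ^^ 1) x = g x"
  by simp

text \<open>The three extra steps lay the marks, ask the oracle and leave the answer state; any
  surplus is spent in the halting configuration, a fixed point.\<close>

lemma machine_correct:
  assumes c: "exec c (input_store n) t s" and d: "exec d (answer_store \<phi> s) u s'"
    and v: "t + u + 3 \<le> v"
  shows "(otm_step (machine c d) \<phi> ^^ v) (otm_init (machine c d) n) =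
    (halt_state (machine c d), tapes_of s')"
proof -
  let ?step = "otm_step (machine c d) \<phi>"
  let ?lc = "length (compile c 1)"
  have code: "oracle_code c d = [IMark] @ compile c 1 @
      [IStop, IGoto (?lc + 3)] @ compile d (?lc + 3) @ [IStop]"
    by (simp add: oracle_code_def Let_def eval_nat_numeral)
  have halt: "halt_state (machine c d) = ?lc + 3 + length (compile d (?lc + 3))"
    and query: "query_state (machine c d) = ?lc + 1"
    by (simp_all add: machine_def code)
  have "map2 act_tape (mark_acts (map read_tape ts)) ts = tapes_of (input_store n)"
    if ts: "ts = word_tape (replicate n (Bit True)) # replicate 15 (word_tape [])" for ts
  proof -
    have "counter_tape 0 = act_tape (Point, Stay) (word_tape [])"
      by (auto simp: counter_tape_def word_tape_def)
    then show ?thesis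
      by (simp add: ts mark_acts_def tapes_of_def input_store_def regs_def eval_nat_numeral)
  qed
  then have 1: "?step (otm_init (machine c d) n) = (1, tapes_of (input_store n))"
    unfolding otm_init_def
    by (subst machine_step) (use halt query in \<open>simp_all add: code machine_def\<close>)
  have 2: "(?step ^^ t) (1, tapes_of (input_store n)) = (?lc + 1, tapes_of s)"
    using compile_correct[OF c, of c d "[IMark]"] code halt query by simp
  have 3: "?step (?lc + 1, tapes_of s) = (?lc + 2, tapes_of (answer_store \<phi> s))"
    using halt query
    by (simp add: otm_step.simps machine_def tapes_of_def answer_store_def)
  have "oracle_code c d ! (?lc + 2) = IGoto (?lc + 3)"
    by (simp add: code nth_append)
  then have 4: "?step (?lc + 2, tapes_of (answer_store \<phi> s)) = (?lc + 3, tapes_of (answer_store \<phi> s))"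
    using halt query by (simp add: machine_step idle_acts_tapes del: One_nat_def)
  have 5: "(?step ^^ u) (?lc + 3, tapes_of (answer_store \<phi> s)) =
      (halt_state (machine c d), tapes_of s')"
    using compile_correct[OF d, of c d "[IMark] @ compile c 1 @ [IStop, IGoto (?lc + 3)]" "[IStop]"]
      code halt query by (simp add: eval_nat_numeral)
  have 6: "(?step ^^ w) (halt_state (machine c d), ts) = (halt_state (machine c d), ts)" for w ts
    by (induction w) (simp_all add: otm_step.simps)
  obtain w where "v = 1 + t + 1 + 1 + u + w"
    using v by (auto simp: le_iff_add)
  then show ?thesis
    by (simp only: funpow_add_apply funpow_one 1 2 3 4 5 6)
qed

subsection \<open>Running times\<close>

text \<open>An upper bound in place of the exact cost allows both alternatives of a
  \<open>Cond\<close>, and all rounds of a loop, to share one estimate.\<close>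

definition runs :: "com \<Rightarrow> store \<Rightarrow> store \<Rightarrow> nat \<Rightarrow> bool" where
  "runs c s s' t \<longleftrightarrow> (\<exists>u\<le>t. exec c s u s')"

lemma runs_weaken: "runs c s s' t \<Longrightarrow> t \<le> t' \<Longrightarrow> runs c s s' t'"
  unfolding runs_def by (meson order_trans)

lemma runs_cong: "runs c s s' t \<Longrightarrow> s' = s'' \<Longrightarrow> t \<le> t' \<Longrightarrow> runs c s s'' t'"
  using runs_weaken by blast

lemma runs_cong_start: "runs c s s' t \<Longrightarrow> s = s0 \<Longrightarrow> s' = s'' \<Longrightarrow> t \<le> t' \<Longrightarrow> runs c s0 s'' t'"
  using runs_weaken by blast

lemma runs_Skip: "runs Skip s s 0"
  by (auto simp: runs_def intro: exec.intros)

lemma runs_Op: "runs (Op a) s (op_sem a s) 1"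
  using exec_Op unfolding runs_def by blast

lemma runs_Seq: "runs c s s' t \<Longrightarrow> runs d s' s'' u \<Longrightarrow> runs (Seq c d) s s'' (t + u)"
  unfolding runs_def by (meson add_le_mono exec_Seq)

lemma runs_While_False: "\<not> test_sem b s \<Longrightarrow> runs (While b c) s s 1"
  using exec_While_False unfolding runs_def by blast

lemma runs_While_True:
  assumes "test_sem b s" "runs c s s' t" "runs (While b c) s' s'' u"
  shows "runs (While b c) s s'' (2 + t + u)"
proof -
  obtain t' u' where "t' \<le> t" "exec c s t' s'" "u' \<le> u" "exec (While b c) s' u' s''"
    using assms by (auto simp: runs_def)
  moreover from this have "exec (While b c) s (2 + t' + u') s''"
    using assms(1) by (blast intro: exec.intros)
  ultimately show ?thesis unfolding runs_def by (intro exI[of _ "2 + t' + u'"]) simp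
qed

lemma runs_Cond:
  assumes "test_sem b s \<Longrightarrow> runs c s s' t" "\<not> test_sem b s \<Longrightarrow> runs d s s' t"
  shows "runs (Cond b c d) s s' (t + 2)"
proof (cases "test_sem b s")
  case True
  then obtain u where "u \<le> t" "exec c s u s'" using assms by (auto simp: runs_def)
  then show ?thesis using True by (auto simp: runs_def intro!: exI[of _ "u + 2"] exec.intros)
next
  case False
  then obtain u where "u \<le> t" "exec d s u s'" using assms by (auto simp: runs_def)
  then show ?thesis using False by (auto simp: runs_def intro!: exI[of _ "u + 1"] exec.intros)
qed

lemma runs_Inc: "runs (Op (Inc i)) (\<rho>, f) (\<rho>, f(i := Suc (f i))) 1"
  using runs_Op[of "Inc i" "(\<rho>, f)"] by simp

lemma runs_Dec: "runs (Op (Dec i)) (\<rho>, f) (\<rho>, f(i := f i - 1)) 1"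
  using runs_Op[of "Dec i" "(\<rho>, f)"] by simp

lemma runs_Tr:
  assumes "i \<noteq> j"
  shows "runs (Op (Tr i j)) (\<rho>, f) (\<rho>, f(i := f i - 1, j := f j + min 1 (f i))) 1"
  using runs_Op[of "Tr i j" "(\<rho>, f)"] assms
  by (auto elim!: runs_cong simp: fun_eq_iff split: if_splits)

lemma runs_Mv:
  "runs (Op (Mv k d)) (\<rho>, f) (\<rho>(k := act_tape (read_tape (\<rho> k), d) (\<rho> k)), f) 1"
  using runs_Op[of "Mv k d" "(\<rho>, f)"] by simp

lemma runs_Wr: "runs (Op (Wr k s d)) (\<rho>, f) (\<rho>(k := act_tape (s, d) (\<rho> k)), f) 1"
  using runs_Op[of "Wr k s d" "(\<rho>, f)"] by simp

lemma runs_While: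
  assumes "\<And>k. k < v \<Longrightarrow> test_sem b (s k)" "\<not> test_sem b (s v)"
    and "\<And>k. k < v \<Longrightarrow> runs c (s k) (s (Suc k)) t"
  shows "runs (While b c) (s 0) (s v) (v * (t + 2) + 1)"
proof -
  \<comment> \<open>The induction counts the rounds that remain, since
    \<open>runs_While_True\<close> adds a round in front.\<close>
  have "runs (While b c) (s (v - k)) (s v) (k * (t + 2) + 1)" if "k \<le> v" for k
    using that
  proof (induction k)
    case 0
    then show ?case using runs_While_False assms(2) by simp
  next
    case (Suc k)
    have "runs c (s (v - Suc k)) (s (v - k)) t"
      using assms(3)[of "v - Suc k"] Suc.prems by (simp add: Suc_diff_Suc)
    from runs_While_True[OF assms(1) this Suc.IH] show ?case
      by (rule runs_weaken) (use Suc.prems in auto)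
  qed
  from this[of v] show ?thesis by simp
qed

lemma runs_countdown:
  assumes "\<And>k. k < v \<Longrightarrow>
    runs c (\<rho> k, (g k)(i := v - k)) (\<rho> (Suc k), (g (Suc k))(i := v - Suc k)) t"
  shows "runs (While (NZ i) c) (\<rho> 0, (g 0)(i := v)) (\<rho> v, (g v)(i := 0)) (v * (t + 2) + 1)"
  using runs_While[of v "NZ i" "\<lambda>k. (\<rho> k, (g k)(i := v - k))", OF _ _ assms] by simp

section \<open>Counted loops, copies and transfers between counters\<close>

definition Loop :: "reg \<Rightarrow> com \<Rightarrow> com" where
  "Loop i c = While (NZ i) (Seq (Op (Dec i)) c)"

text \<open>\<open>x\<close> is a scratch counter, from which \<open>i\<close> is restored.\<close>

definition For :: "reg \<Rightarrow> reg \<Rightarrow> com \<Rightarrow> com" where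
  "For i x c = Seq (Loop i (Seq c (Op (Inc x)))) (Loop x (Op (Inc i)))"

fun Add :: "reg \<Rightarrow> nat \<Rightarrow> com" where
  "Add i 0 = Skip"
| "Add i (Suc k) = Seq (Op (Inc i)) (Add i k)"

lemma runs_Loop:
  assumes "\<And>k. k < v \<Longrightarrow>
    runs c (\<rho> k, (g k)(i := v - Suc k)) (\<rho> (Suc k), (g (Suc k))(i := v - Suc k)) t"
  shows "runs (Loop i c) (\<rho> 0, (g 0)(i := v)) (\<rho> v, (g v)(i := 0)) (v * (t + 3) + 1)"
proof -
  have "runs (Seq (Op (Dec i)) c)
      (\<rho> k, (g k)(i := v - k)) (\<rho> (Suc k), (g (Suc k))(i := v - Suc k)) (1 + t)" if "k < v" for k
    using that by (intro runs_Seq[OF _ assms[OF that]] runs_cong[OF runs_Dec]) auto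
  from runs_countdown[OF this] show ?thesis by (simp add: Loop_def numeral_3_eq_3 add.commute)
qed

lemma runs_Loop_Op:
  assumes "\<And>k. k < v \<Longrightarrow>
    runs c (\<rho>, (g k)(i := v - Suc k)) (\<rho>, (g (Suc k))(i := v - Suc k)) t"
    and "f = (g 0)(i := v)"
  shows "runs (Loop i c) (\<rho>, f) (\<rho>, (g v)(i := 0)) (v * (t + 3) + 1)"
  using runs_Loop[of v c "\<lambda>_. \<rho>" g i t] assms by simp

lemma runs_Add: "runs (Add i k) (\<rho>, f) (\<rho>, f(i := f i + k)) k"
proof (induction k arbitrary: f)
  case 0
  then show ?case using runs_Skip by simp
next
  case (Suc k)
  show ?case unfolding Add.simps by (rule runs_cong[OF runs_Seq[OF runs_Inc Suc.IH]]) auto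
qed

lemma runs_Loop_Add:
  assumes "i \<noteq> j"
  shows "runs (Loop i (Add j k)) (\<rho>, f) (\<rho>, f(i := 0, j := f j + k * f i)) (f i * (k + 3) + 1)"
  using assms
  by (intro runs_cong[OF runs_Loop_Op[where g = "\<lambda>a. f(j := f j + k * a)" and v = "f i" and t = k]]
      runs_cong[OF runs_Add]) (auto simp: fun_eq_iff)

lemma runs_Loop_Inc:
  assumes "i \<noteq> j"
  shows "runs (Loop i (Op (Inc j))) (\<rho>, f) (\<rho>, f(i := 0, j := f j + f i)) (f i * 4 + 1)"
  using assms
  by (intro runs_cong[OF runs_Loop_Op[where g = "\<lambda>a. f(j := f j + a)" and v = "f i" and t = 1]]
      runs_cong[OF runs_Inc]) (auto simp: fun_eq_iff)

lemma runs_Loop_Inc_Add: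
  assumes "i \<noteq> j" "i \<noteq> l" "j \<noteq> l"
  shows "runs (Loop i (Seq (Op (Inc j)) (Add l k))) (\<rho>, f)
    (\<rho>, f(i := 0, j := f j + f i, l := f l + k * f i)) (f i * (k + 4) + 1)"
  using assms
  by (intro runs_cong[OF runs_Loop_Op[where v = "f i" and t = "1 + k" and
        g = "\<lambda>a. f(j := f j + a, l := f l + k * a)"]]
      runs_cong[OF runs_Seq[OF runs_Inc runs_Add]]) (auto simp: fun_eq_iff)

text \<open>Once \<open>j\<close> is empty, further transfers do nothing, whence the minimum;
  \<open>bit_step\<close> uses this as its clamp at the upper end.\<close>

lemma runs_Loop_Tr:
  assumes "i \<noteq> j" "i \<noteq> l" "j \<noteq> l"
  shows "runs (Loop i (Op (Tr j l))) (\<rho>, f)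
    (\<rho>, f(i := 0, j := f j - f i, l := f l + min (f i) (f j))) (f i * 4 + 1)"
  using assms
  by (intro runs_cong[OF runs_Loop_Op[where v = "f i" and t = 1 and
        g = "\<lambda>a. f(j := f j - a, l := f l + min a (f j))"]]
      runs_cong[OF runs_Tr]) (auto simp: fun_eq_iff)

lemma runs_For:
  assumes "i \<noteq> x" "\<And>k. k < v \<Longrightarrow> runs c (\<rho> k, (g k)(i := v - Suc k, x := k))
      (\<rho> (Suc k), (g (Suc k))(i := v - Suc k, x := k)) t"
  shows "runs (For i x c) (\<rho> 0, (g 0)(i := v, x := 0)) (\<rho> v, (g v)(i := v, x := 0)) (v * (t + 8) + 2)"
proof -
  have "runs (Seq c (Op (Inc x))) (\<rho> k, ((g k)(x := k))(i := v - Suc k))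
      (\<rho> (Suc k), ((g (Suc k))(x := Suc k))(i := v - Suc k)) (t + 1)" if "k < v" for k
    by (rule runs_cong[OF runs_Seq[OF runs_cong_start[OF assms(2)[OF that]] runs_Inc]])
      (use \<open>i \<noteq> x\<close> in auto)
  from runs_Loop[of v _ \<rho> "\<lambda>k. (g k)(x := k)" i, OF this]
  show ?thesis unfolding For_def
    by (rule runs_cong_start[OF runs_Seq[OF _ runs_Loop_Inc[of x i]]])
      (use \<open>i \<noteq> x\<close> in \<open>auto simp: fun_eq_iff algebra_simps\<close>)
qed

lemma runs_For_Op:
  assumes "i \<noteq> x" "f x = 0" "f = (g 0)(i := f i, x := 0)"
    and "\<And>k. k < f i \<Longrightarrow> runs c (\<rho>, (g k)(i := f i - Suc k, x := k))
      (\<rho>, (g (Suc k))(i := f i - Suc k, x := k)) 1"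
  shows "runs (For i x c) (\<rho>, f) (\<rho>, (g (f i))(i := f i, x := 0)) (f i * 9 + 2)"
  using runs_For[OF assms(1), of "f i" c "\<lambda>_. \<rho>" g 1] assms by simp

lemma runs_For_Inc:
  assumes "f x = 0" "distinct [i, x, j]"
  shows "runs (For i x (Op (Inc j))) (\<rho>, f) (\<rho>, f(j := f j + f i)) (f i * 9 + 2)"
  using assms
  by (intro runs_cong[OF runs_For_Op[where g = "\<lambda>a. f(j := f j + a)"]] runs_cong[OF runs_Inc])
    (auto simp: fun_eq_iff)

lemma runs_For_Dec:
  assumes "f x = 0" "distinct [i, x, j]"
  shows "runs (For i x (Op (Dec j))) (\<rho>, f) (\<rho>, f(j := f j - f i)) (f i * 9 + 2)"
  using assms
  by (intro runs_cong[OF runs_For_Op[where g = "\<lambda>a. f(j := f j - a)"]] runs_cong[OF runs_Dec])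
    (auto simp: fun_eq_iff)

lemma runs_For_Tr:
  assumes "f x = 0" "distinct [i, x, j, l]"
  shows "runs (For i x (Op (Tr j l))) (\<rho>, f)
    (\<rho>, f(j := f j - f i, l := f l + min (f i) (f j))) (f i * 9 + 2)"
  using assms
  by (intro runs_cong[OF runs_For_Op[where g = "\<lambda>a. f(j := f j - a, l := f l + min a (f j))"]]
      runs_cong[OF runs_Tr]) (auto simp: fun_eq_iff)

subsection \<open>Approximation of the function\<close>

definition clip :: "real \<Rightarrow> real" where
  "clip u = max 0 (min 1 u)"

text \<open>With \<open>j = q - p\<close>, this is \<open>R\<close> after \<open>i\<close> fractional digits.\<close>

definition residue :: "real \<Rightarrow> nat \<Rightarrow> nat \<Rightarrow> nat \<Rightarrow> nat \<Rightarrow> nat" where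
  "residue d C q j i =
     nat (max 0 (min (int C) (int q * \<lfloor>d * 2 ^ i\<rfloor> - (int q - int j) * 2 ^ i + int q)))"

text \<open>Of the \<open>q + m\<close> digits, \<open>q\<close> supply the slope
  \<open>2 ^ q\<close> and \<open>m\<close> the scale \<open>2 ^ m\<close>. The truncated
  subtraction undoes the shift and clips at 0 at once.\<close>

definition piece :: "real \<Rightarrow> nat \<Rightarrow> nat \<Rightarrow> nat \<Rightarrow> nat" where
  "piece d m q j = residue d (2 ^ m) q j (q + m) - q"

text \<open>The quotient is rounded up because this is what a loop of truncated subtractions counts:
  its last round may remove less than \<open>q\<close>.\<close>

definition cdiv :: "nat \<Rightarrow> nat \<Rightarrow> nat" where
  "cdiv a q = (a + q - 1) div q"

text \<open>Three divisions by \<open>q\<close> avoid a counter for \<open>q ^ 3\<close>. The offset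
  \<open>q - p\<close> is what \<open>Off\<close> holds while it counts down.\<close>

definition level :: "real \<Rightarrow> nat \<Rightarrow> nat \<Rightarrow> nat" where
  "level d m q = cdiv (cdiv (cdiv (\<Sum>p<q. piece d m q (q - p)) q) q) q"

definition approx :: "real \<Rightarrow> nat \<Rightarrow> nat \<Rightarrow> nat" where
  "approx d m N = (\<Sum>k<N. level d m (N - k))"

section \<open>Recurrence and error of the residues\<close>

lemma residue_0:
  assumes "0 \<le> d" "d < 2" "j \<le> q" "2 * q \<le> C"
  shows "residue d C q j 0 = j + (if odd \<lfloor>d\<rfloor> then q else 0)"
proof -
  \<comment> \<open>An approximation of a point of the unit interval may exceed 1, so the integer
    digit can be 1; then \<open>2 * q \<le> C\<close> keeps \<open>j + q\<close> unclamped.\<close>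
  have "\<lfloor>d\<rfloor> = 0 \<or> \<lfloor>d\<rfloor> = 1" using assms by linarith
  then show ?thesis using assms by (auto simp: residue_def)
qed

lemma floor_double: "\<lfloor>d * 2 ^ Suc i\<rfloor> = 2 * \<lfloor>d * 2 ^ i\<rfloor> + of_bool (odd \<lfloor>d * 2 ^ Suc i\<rfloor>)" for d :: real
proof -
  define y where "y = \<lfloor>d * 2 ^ Suc i\<rfloor>"
  have "y div 2 = \<lfloor>d * 2 ^ i\<rfloor>"
    using floor_divide_real_eq_div[of 2 "d * 2 ^ Suc i"] by (simp add: y_def)
  then show ?thesis unfolding y_def[symmetric] by (cases "even y") (auto elim!: evenE oddE)
qed

text \<open>Clamping commutes with the recurrence: beyond either end of the range the step moves
  further outwards, at the upper end because \<open>q \<le> C\<close>.\<close>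

lemma residue_Suc:
  assumes "q \<le> C"
  shows "residue d C q j (Suc i) =
    min C (2 * residue d C q j i - (if odd \<lfloor>d * 2 ^ Suc i\<rfloor> then 0 else q))"
proof -
  define y where "y = int q * \<lfloor>d * 2 ^ i\<rfloor> - (int q - int j) * 2 ^ i + int q"
  define b :: int where "b = of_bool (odd \<lfloor>d * 2 ^ Suc i\<rfloor>)"
  have "int q * \<lfloor>d * 2 ^ Suc i\<rfloor> - (int q - int j) * 2 ^ Suc i + int q =
      2 * y - (if odd \<lfloor>d * 2 ^ Suc i\<rfloor> then 0 else int q)"
    by (subst floor_double) (auto simp: y_def algebra_simps)
  then show ?thesis
    using assms unfolding residue_def y_def[symmetric] by (auto simp: max_def min_def)
qed

text \<open>Three errors of at most \<open>q\<close> each: the oracle's error and the rounding by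
  the floor, each at most one unit of the last digit and multiplied by \<open>q\<close>, and the
  upper clamp, which acts before the shift is undone and so cuts at \<open>C - q\<close> instead of
  \<open>C\<close>.\<close>

lemma piece_error:
  assumes d: "\<bar>d - x\<bar> \<le> 1 / 2 ^ K" and "q + m \<le> K" "p < q" "q \<le> 2 ^ m"
  shows "\<bar>real (piece d m q (q - p)) - 2 ^ m * clip (2 ^ q * (real q * x - real p))\<bar> \<le> 3 * real q"
proof -
  define L where "L = q + m"
  define C :: real where "C = 2 ^ m"
  define r where "r = real q * real_of_int \<lfloor>d * 2 ^ L\<rfloor> - real p * 2 ^ L"
  define y where "y = 2 ^ L * (real q * x - real p)"
  have C: "real q \<le> C" using assms(4) by (metis C_def of_nat_le_iff of_nat_numeral of_nat_power)
  have "C * clip (2 ^ q * (real q * x - real p)) = max (C * 0) (C * min 1 (2 ^ q * (real q * x - real p)))"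
    unfolding clip_def by (subst max_mult_distrib_left) (auto simp: C_def)
  also have "\<dots> = max 0 (min C y)"
    by (subst min_mult_distrib_left) (auto simp: C_def y_def L_def power_add mult_ac)
  finally have 1: "2 ^ m * clip (2 ^ q * (real q * x - real p)) = max 0 (min C y)"
    by (simp add: C_def)
  have "int (residue d (2 ^ m) q (q - p) L) =
      max 0 (min (2 ^ m) (int q * \<lfloor>d * 2 ^ L\<rfloor> - int p * 2 ^ L + int q))"
    using \<open>p < q\<close> by (simp add: residue_def of_nat_diff)
  then have "real_of_int (int (residue d (2 ^ m) q (q - p) L)) = max 0 (min C (r + real q))"
    by (simp add: C_def r_def of_int_max of_int_min)
  then have 2: "real (piece d m q (q - p)) = max 0 (min C (r + real q) - real q)"
  proof -
    have "real (a - b) = max 0 (real a - real b)" for a b :: nat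
      by (cases "b \<le> a") (auto simp: of_nat_diff)
    moreover have "max 0 (max 0 u - real q) = max 0 (u - real q)" for u
      by (auto simp: max_def)
    ultimately show ?thesis using \<open>real_of_int _ = _\<close> by (simp add: piece_def flip: L_def)
  qed
  have "2 ^ L * \<bar>d - x\<bar> \<le> 2 ^ L * (1 / 2 ^ K)" using d by (intro mult_left_mono) auto
  also have "\<dots> \<le> 1" using assms(2) by (simp add: L_def)
  finally have "2 ^ L * \<bar>d - x\<bar> \<le> 1" .
  moreover have "\<bar>d * 2 ^ L - x * 2 ^ L\<bar> = 2 ^ L * \<bar>d - x\<bar>"
    by (simp add: abs_mult flip: left_diff_distrib)
  ultimately have "\<bar>d * 2 ^ L - x * 2 ^ L\<bar> \<le> 1" by simp
  then have "\<bar>real_of_int \<lfloor>d * 2 ^ L\<rfloor> - x * 2 ^ L\<bar> \<le> 2" by linarith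
  then have "real q * \<bar>real_of_int \<lfloor>d * 2 ^ L\<rfloor> - x * 2 ^ L\<bar> \<le> real q * 2" by (intro mult_left_mono) auto
  moreover have "real q * \<bar>real_of_int \<lfloor>d * 2 ^ L\<rfloor> - x * 2 ^ L\<bar> = \<bar>r - y\<bar>"
  proof -
    have "r - y = real q * (real_of_int \<lfloor>d * 2 ^ L\<rfloor> - x * 2 ^ L)"
      by (simp add: r_def y_def algebra_simps)
    then show ?thesis by (simp add: abs_mult)
  qed
  ultimately have "\<bar>r - y\<bar> \<le> 2 * real q" by simp
  then show ?thesis unfolding 1 2 using C by (auto simp: max_def min_def)
qed

section \<open>Rounding errors and the tail of the series\<close>

lemma beta_fn_clip: 
  "beta_fn p q x = clip (2 ^ q * (real q * x - real p)) / real q" if "q \<ge> 1"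
proof -
  define t where "t = real q * x - real p"
  have "x \<le> real p / real q \<longleftrightarrow> t \<le> 0" "x \<le> (real p + 1 / 2 ^ q) / real q \<longleftrightarrow> 2 ^ q * t \<le> 1"
    "2 ^ q * (x - real p / real q) = 2 ^ q * t / real q"
    using that by (auto simp: t_def field_simps)
  moreover have "t \<le> 0 \<longleftrightarrow> 2 ^ q * t \<le> 0" using mult_le_cancel_left_pos[of "2 ^ q" t 0] by simp
  ultimately show ?thesis unfolding t_def[symmetric] beta_fn_def
    by (simp add: clip_def max_def min_def)
qed

lemma alpha_fn_clip:
  "q \<ge> 1 \<Longrightarrow> alpha_fn q x = (\<Sum>p<q. clip (2 ^ q * (real q * x - real p))) / real q"
  by (simp add: alpha_fn_def beta_fn_clip sum_divide_distrib)

lemma alpha_fn_bounds: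
  assumes "q \<ge> 1" shows "0 \<le> alpha_fn q x" "alpha_fn q x \<le> 1"
proof -
  have "(\<Sum>p<q. clip (2 ^ q * (real q * x - real p))) \<le> (\<Sum>p<q. 1)"
    by (intro sum_mono) (auto simp: clip_def)
  then show "alpha_fn q x \<le> 1" using assms by (simp add: alpha_fn_clip)
  show "0 \<le> alpha_fn q x"
    by (simp add: alpha_fn_clip[OF assms] clip_def sum_nonneg)
qed

lemma cdiv_bounds:
  assumes "q \<ge> 1"
  shows "real a / real q \<le> real (cdiv a q)" "real (cdiv a q) \<le> real a / real q + 1"
proof -
  have "a \<le> q * cdiv a q"
    using dividend_less_times_div[of q "a + q - 1"] assms by (simp add: cdiv_def)
  then have "real a \<le> real q * real (cdiv a q)" by (metis of_nat_le_iff of_nat_mult)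
  then show "real a / real q \<le> real (cdiv a q)" using assms by (simp add: field_simps)
  have "q * cdiv a q \<le> a + q - 1" by (simp add: cdiv_def)
  then have "q * cdiv a q \<le> a + q" by simp
  then have "real q * real (cdiv a q) \<le> real a + real q" by (metis of_nat_le_iff of_nat_mult of_nat_add)
  then show "real (cdiv a q) \<le> real a / real q + 1" using assms by (simp add: field_simps)
qed

text \<open>Each rounding adds at most 1, and later divisions do not enlarge what the earlier ones
  added.\<close>

lemma cdiv_cube_error:
  assumes "q \<ge> 1"
  shows "\<bar>real (cdiv (cdiv (cdiv a q) q) q) - real a / real q ^ 3\<bar> \<le> 3"
proof -
  have mono: "u / real q \<le> v / real q" if "u \<le> v" for u v using that by (simp add: divide_right_mono)
  have shrink: "1 / real q \<le> 1" using assms by simp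
  note b = cdiv_bounds[OF assms]
  have "real a / real q / real q / real q \<le> real (cdiv (cdiv (cdiv a q) q) q)"
    by (meson b(1) mono order_trans)
  moreover have "real (cdiv (cdiv (cdiv a q) q) q) \<le> real a / real q / real q / real q + 3"
  proof -
    have "real (cdiv (cdiv a q) q) \<le> real a / real q / real q + 1 / real q + 1"
      using b(2)[of "cdiv a q"] mono[OF b(2)[of a]] by (simp add: add_divide_distrib)
    then have "real (cdiv (cdiv a q) q) \<le> real a / real q / real q + 2" using shrink by simp
    from mono[OF this] have "real (cdiv (cdiv a q) q) / real q \<le>
        real a / real q / real q / real q + 2 * (1 / real q)"
      by (simp add: add_divide_distrib)
    then show ?thesis using b(2)[of "cdiv (cdiv a q) q"] shrink by linarith
  qed
  moreover have "real a / real q / real q / real q = real a / real q ^ 3"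
    by (simp add: power3_eq_cube)
  ultimately show ?thesis by linarith
qed

text \<open>The \<open>q\<close> pieces are off by \<open>3 * q\<close> each, hence by at most 3
  after division by \<open>q ^ 3\<close>; the three roundings contribute another 3.\<close>

lemma level_error:
  assumes "\<bar>d - x\<bar> \<le> 1 / 2 ^ K" "q + m \<le> K" "q \<le> 2 ^ m" "q \<ge> 1"
  shows "\<bar>real (level d m q) / 2 ^ m - 1 / real q ^ 2 * alpha_fn q x\<bar> \<le> 6 / 2 ^ m"
proof -
  define a where "a = (\<Sum>p<q. piece d m q (q - p))"
  define s where "s = (\<Sum>p<q. clip (2 ^ q * (real q * x - real p)))"
  have "\<bar>real a - 2 ^ m * s\<bar> \<le> (\<Sum>p<q. 3 * real q)"
    unfolding a_def s_def of_nat_sum sum_distrib_left sum_subtractf[symmetric]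
    by (intro order_trans[OF sum_abs] sum_mono piece_error[OF assms(1,2) _ assms(3)]) auto
  then have "\<bar>real a - 2 ^ m * s\<bar> / real q ^ 3 \<le> 3 * real q ^ 2 / real q ^ 3"
    by (intro divide_right_mono) (auto simp: power2_eq_square mult_ac)
  also have "\<dots> \<le> 3" using assms(4) by (simp add: power2_eq_square power3_eq_cube field_simps)
  finally have "\<bar>(real a - 2 ^ m * s) / real q ^ 3\<bar> \<le> 3" by (simp add: abs_divide)
  then have "\<bar>real a / real q ^ 3 - 2 ^ m * (s / real q ^ 3)\<bar> \<le> 3"
    by (simp add: diff_divide_distrib)
  moreover have "1 / real q ^ 2 * alpha_fn q x = s / real q ^ 3"
    by (simp add: alpha_fn_clip[OF assms(4)] s_def power2_eq_square power3_eq_cube)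
  moreover have "\<bar>real (level d m q) - real a / real q ^ 3\<bar> \<le> 3"
    unfolding level_def a_def by (rule cdiv_cube_error[OF assms(4)])
  ultimately have "\<bar>real (level d m q) - 2 ^ m * (1 / real q ^ 2 * alpha_fn q x)\<bar> \<le> 6" by simp
  then have "\<bar>real (level d m q) - 2 ^ m * (1 / real q ^ 2 * alpha_fn q x)\<bar> / 2 ^ m \<le> 6 / 2 ^ m"
    by (rule divide_right_mono) simp
  moreover have "u / 2 ^ m - w = (u - 2 ^ m * w) / 2 ^ m" for u w :: real
    by (simp add: diff_divide_distrib)
  ultimately show ?thesis by (metis abs_divide power_abs abs_numeral)
qed

text \<open>Since \<open>alpha_fn\<close> is at most 1, the term for q is at most 1 / ((q - 1) q) =
  1 / (q - 1) - 1 / q, which telescopes.\<close>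

lemma calF_tail:
  assumes "N \<ge> 1"
  shows "\<bar>calF x - (\<Sum>k<N. 1 / real (Suc k) ^ 2 * alpha_fn (Suc k) x)\<bar> \<le> 1 / real N"
proof -
  define g where "g k = 1 / real (Suc k) ^ 2 * alpha_fn (Suc k) x" for k
  define h where "h k = 1 / real (k + N) - 1 / real (Suc k + N)" for k
  have "(\<lambda>k. 1 / real (k + N)) \<longlonglongrightarrow> 0"
    using LIMSEQ_ignore_initial_segment[OF lim_inverse_n', of N] by (simp add: inverse_eq_divide)
  from telescope_sums'[OF this] have h: "h sums (1 / real N)" by (simp add: h_def[abs_def])
  have g: "0 \<le> g k" for k using alpha_fn_bounds[of "Suc k"] by (simp add: g_def)
  have gh: "g (k + N) \<le> h k" for k
  proof -
    have "g (k + N) \<le> 1 / real (Suc (k + N)) ^ 2 * 1"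
      unfolding g_def by (intro mult_left_mono alpha_fn_bounds) auto
    also have "\<dots> \<le> 1 / (real (k + N) * real (Suc (k + N)))"
      unfolding power2_eq_square using assms by (auto intro!: divide_left_mono mult_right_mono)
    also have "\<dots> = h k"
      using assms by (simp add: h_def field_simps)
    finally show ?thesis .
  qed
  \<comment> \<open>Convergence of the series defining \<open>calF\<close> is part of the claim, as
    \<open>suminf\<close> alone does not guarantee it.\<close>
  have sg: "summable (\<lambda>k. g (k + N))"
    by (rule summable_comparison_test'[OF sums_summable[OF h], of 0]) (use g gh in auto)
  then have "suminf g = (\<Sum>k. g (k + N)) + (\<Sum>k<N. g k)"
    using suminf_split_initial_segment summable_iff_shift by blast
  moreover have "(\<Sum>k. g (k + N)) \<le> 1 / real N"
    using suminf_le[OF gh sg sums_summable[OF h]] sums_unique[OF h] by simp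
  moreover have "0 \<le> (\<Sum>k. g (k + N))" using g sg by (intro suminf_nonneg) auto
  moreover have "calF x = suminf g" by (simp add: calF_def g_def[abs_def])
  ultimately show ?thesis by (simp add: g_def)
qed

lemma approx_error:
  assumes "\<bar>d - x\<bar> \<le> 1 / 2 ^ K" "N + m \<le> K" "N \<le> 2 ^ m" "N \<ge> 1"
  shows "\<bar>real (approx d m N) / 2 ^ m - calF x\<bar> \<le> 6 * real N / 2 ^ m + 1 / real N"
proof -
  have "approx d m N = (\<Sum>k<N. level d m (Suc k))"
    unfolding approx_def by (subst sum.nat_diff_reindex[symmetric]) (auto intro!: sum.cong simp: Suc_diff_Suc)
  then have "real (approx d m N) / 2 ^ m - (\<Sum>k<N. 1 / real (Suc k) ^ 2 * alpha_fn (Suc k) x) =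
      (\<Sum>k<N. real (level d m (Suc k)) / 2 ^ m - 1 / real (Suc k) ^ 2 * alpha_fn (Suc k) x)"
    by (simp add: sum_subtractf sum_divide_distrib)
  also have "\<bar>\<dots>\<bar> \<le> (\<Sum>k<N. 6 / 2 ^ m)"
    using assms by (intro order_trans[OF sum_abs] sum_mono level_error[OF assms(1)]) auto
  finally have "\<bar>real (approx d m N) / 2 ^ m -
      (\<Sum>k<N. 1 / real (Suc k) ^ 2 * alpha_fn (Suc k) x)\<bar> \<le> 6 * real N / 2 ^ m"
    by (simp only: sum_constant card_lessThan times_divide_eq_right mult.commute)
  then show ?thesis using calF_tail[OF assms(4), of x] by linarith
qed

text \<open>The first term and the tail behind it are at most 1 each. With an output error of at
  most 1 the printed number stays below 4, so two integer digits suffice.\<close>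

lemma calF_le_2: "calF x \<le> 2"
  using calF_tail[of 1 x] alpha_fn_bounds[of 1 x] by simp

text \<open>For \<open>d = 0\<close> the unclamped residue is \<open>q - p * 2 ^ i\<close>, at most
  \<open>q\<close>, and the final subtraction of \<open>q\<close> leaves nothing.\<close>

lemma piece_zero: "p < q \<Longrightarrow> piece 0 m q (q - p) = 0"
  by (auto simp: piece_def residue_def of_nat_diff nat_le_iff min_le_iff_disj)

lemma approx_zero: "approx 0 m N = 0"
proof -
  have "level 0 m q = 0" for q
  proof -
    have "cdiv 0 q = 0" by (cases q) (auto simp: cdiv_def)
    then show ?thesis by (simp add: level_def piece_zero)
  qed
  then show ?thesis by (simp add: approx_def)
qed

text \<open>Behind the end of the answer the tape is blank, and the digit tests, which compare with
  \<open>Bit True\<close>, take a blank for the digit 0. This is the justification.\<close>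

lemma dyadic_digit_beyond:
  assumes "d \<in> dyadic_rationals" "dyadic_prec d \<le> i"
  shows "even \<lfloor>d * 2 ^ Suc i\<rfloor>"
proof -
  obtain a k where "d = real_of_int a / 2 ^ k" using assms by (auto simp: dyadic_rationals_def)
  then have "d * 2 ^ k \<in> \<int>" by simp
  then have "d * 2 ^ dyadic_prec d \<in> \<int>" unfolding dyadic_prec_def by (rule LeastI)
  moreover have "(2::real) ^ i = 2 ^ dyadic_prec d * 2 ^ (i - dyadic_prec d)"
    using assms(2) by (simp flip: power_add)
  ultimately have "d * 2 ^ i \<in> \<int>" by (auto simp flip: mult.assoc)
  then obtain z where "d * 2 ^ i = real_of_int z" by (auto elim: Ints_cases)
  then have "d * 2 ^ Suc i = real_of_int (2 * z)" by simp
  then show ?thesis by (simp only: floor_of_int) simp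
qed

text \<open>Below 2 the integer part is the single cell 0 and the point is cell 1, whence the offset
  2 of the fractional digits.\<close>

lemma dyadic_word_digits:
  assumes "d \<in> dyadic_rationals" "0 \<le> d" "d < 2"
  shows "fst (word_tape (dyadic_word d)) 0 = Bit (odd \<lfloor>d\<rfloor>)"
    "fst (word_tape (dyadic_word d)) (int i + 2) = Bit True \<longleftrightarrow> odd \<lfloor>d * 2 ^ Suc i\<rfloor>"
proof -
  have "nat \<lfloor>d\<rfloor> < 2" "odd (nat \<lfloor>d\<rfloor>) = odd \<lfloor>d\<rfloor>"
    using assms by (auto simp: even_nat_iff nat_less_iff floor_less_iff)
  then have w: "dyadic_word d = Bit (odd \<lfloor>d\<rfloor>) # Point #
      map (\<lambda>i. Bit (odd \<lfloor>d * 2 ^ Suc i\<rfloor>)) [0..<dyadic_prec d]"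
    using assms by (simp add: dyadic_word_def nat_bits.simps)
  show "fst (word_tape (dyadic_word d)) 0 = Bit (odd \<lfloor>d\<rfloor>)"
    by (simp add: w word_tape_def)
  show "fst (word_tape (dyadic_word d)) (int i + 2) = Bit True \<longleftrightarrow> odd \<lfloor>d * 2 ^ Suc i\<rfloor>"
    using dyadic_digit_beyond[OF assms(1), of i]
    by (auto simp: w word_tape_def nat_add_distrib eval_nat_numeral simp del: power_Suc)
qed

lemma dyadic_word_Minus: "fst (word_tape (dyadic_word d)) 0 = Minus \<longleftrightarrow> d < 0"
proof -
  have "nat_bits k \<noteq> []" for k by (subst nat_bits.simps) simp
  then obtain b bs where "nat_bits (nat \<lfloor>\<bar>d\<bar>\<rfloor>) = b # bs" by (meson list.exhaust)
  then show ?thesis by (auto simp: word_tape_def dyadic_word_def)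
qed

subsection \<open>The query\<close>

definition grow :: com where
  "grow = Op (Mv 0 Right) ;; Loop Den (Add Twice 2) ;; Loop Twice (Op (Inc Den)) ;;
     Loop Slack (Add Twice 4) ;; Loop Twice (Op (Inc Slack)) ;; Add Prec 2"

text \<open>The constants 2, 5 and 32 are N, m and C for input 0; each input symbol doubles N, adds
  2 to m and quadruples C.\<close>

definition ask :: com where
  "ask = (Add Den 2 ;; Add Prec 5 ;; Add Slack 32) ;; While (Rd 0 (Bit True)) grow ;;
     For Slack Spare (Op (Wr 1 (Bit True) Right))"

definition written_tape :: "symbol list \<Rightarrow> tape" where
  "written_tape w = (fst (word_tape w), int (length w))"

lemma written_tape_Nil: "written_tape [] = word_tape []"
  by (simp add: written_tape_def word_tape_def)

lemma act_written_tape: "act_tape (s, Right) (written_tape w) = written_tape (w @ [s])"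
  by (auto simp: written_tape_def word_tape_def fun_eq_iff nth_append)

lemma tape_output_written_tape: "Blank \<notin> set w \<Longrightarrow> tape_output (written_tape w) w"
  by (auto simp: tape_output_def written_tape_def word_tape_def)

lemma query_arg_written_tape: "query_arg (written_tape (replicate k (Bit True))) = k"
  unfolding query_arg_def
  by (rule Least_equality) (auto simp: written_tape_def word_tape_def not_less[symmetric])

lemma runs_grow:
  assumes "f Twice = 0" "\<rho> 0 = (c, h)"
  shows "runs grow (\<rho>, f)
    (\<rho>(0 := (c, h + 1)), f(Den := 2 * f Den, Slack := 4 * f Slack, Prec := f Prec + 2))
    (13 * f Den + 23 * f Slack + 7)"
  unfolding grow_def using assms
  by (intro runs_cong[OF runs_Seq[OF runs_Mv runs_Seq[OF runs_Loop_Add runs_Seq[OF runs_Loop_Inc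
        runs_Seq[OF runs_Loop_Add runs_Seq[OF runs_Loop_Inc runs_Add]]]]]])
    (auto simp: fun_eq_iff)

definition ask_store :: "nat \<Rightarrow> store" where
  "ask_store n = ((\<lambda>k. word_tape [])
       (0 := (fst (word_tape (replicate n (Bit True))), int n),
        1 := written_tape (replicate (2 ^ (2 * n + 5)) (Bit True))),
     (\<lambda>r. 0)(Den := 2 ^ Suc n, Prec := 2 * n + 5, Slack := 2 ^ (2 * n + 5)))"

lemma runs_ask: "runs ask (input_store n) (ask_store n) (200 * (2 ^ (2 * n + 5)) ^ 2)"
proof -
  define C :: nat where "C = 2 ^ (2 * n + 5)"
  define t where "t = fst (word_tape (replicate n (Bit True)))"
  define f :: "nat \<Rightarrow> reg \<Rightarrow> nat" where "f k = (\<lambda>r. 0)(Den := 2 ^ Suc k, Prec := 2 * k + 5, Slack := 2 ^ (2 * k + 5))"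
    for k
  define \<rho> :: "nat \<Rightarrow> nat \<Rightarrow> tape" where "\<rho> k = (\<lambda>k. word_tape [])(0 := (t, int k))" for k
  have input: "input_store n = (\<rho> 0, \<lambda>r. 0)"
    by (auto simp: input_store_def \<rho>_def t_def word_tape_def fun_eq_iff)
  have n: "n \<le> C" unfolding C_def
    by (rule less_imp_le[OF less_le_trans[OF less_exp]]) (simp add: power_increasing)
  have init: "runs (Add Den 2 ;; Add Prec 5 ;; Add Slack 32) (\<rho> 0, \<lambda>r. 0) (\<rho> 0, f 0) 39"
    by (rule runs_cong[OF runs_Seq[OF runs_Add runs_Seq[OF runs_Add runs_Add]]])
      (auto simp: f_def fun_eq_iff)
  have "runs grow (\<rho> k, f k) (\<rho> (Suc k), f (Suc k)) (36 * C + 7)" if "k < n" for k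
  proof (rule runs_cong[OF runs_grow[where c = t and h = "int k"]])
    have "(2::nat) ^ Suc k \<le> C" "(2::nat) ^ (2 * k + 5) \<le> C"
      using that unfolding C_def by (auto intro!: power_increasing simp del: power_Suc)
    then show "13 * f k Den + 23 * f k Slack + 7 \<le> 36 * C + 7" by (simp add: f_def)
  qed (auto simp: f_def \<rho>_def fun_eq_iff power_add)
  then have loop: "runs (While (Rd 0 (Bit True)) grow) (\<rho> 0, f 0) (\<rho> n, f n) (n * (36 * C + 7 + 2) + 1)"
    by (rule runs_While[where s = "\<lambda>k. (\<rho> k, f k)", rotated 2])
      (auto simp: \<rho>_def t_def word_tape_def)
  let ?\<rho> = "\<lambda>k. (\<rho> n)(1 := written_tape (replicate k (Bit True)))"
  have *: "\<rho> n = ?\<rho> 0" "f n = (f n)(Slack := C, Spare := 0)" "ask_store n = (?\<rho> C, f n)"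
    by (auto simp: \<rho>_def f_def fun_eq_iff written_tape_Nil ask_store_def t_def C_def)
  \<comment> \<open>The unary argument is written with \<open>For\<close>, not \<open>Loop\<close>,
    since \<open>Slack\<close> must still hold \<open>C\<close> after the query.\<close>
  have query: "runs (For Slack Spare (Op (Wr 1 (Bit True) Right))) (\<rho> n, f n) (ask_store n) (C * (1 + 8) + 2)"
  proof (rule runs_cong_start[OF runs_For[where \<rho> = ?\<rho> and g = "\<lambda>_. f n" and v = C and t = 1]])
    show "(?\<rho> 0, (f n)(Slack := C, Spare := 0)) = (\<rho> n, f n)"
      "(?\<rho> C, (f n)(Slack := C, Spare := 0)) = ask_store n"
      using * by metis+
  qed (auto intro!: runs_cong[OF runs_Wr] simp: act_written_tape replicate_append_same)
  have C2: "C \<le> C * C" "1 \<le> C" by (auto simp: C_def)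
  have "n * (36 * C + 7 + 2) \<le> C * (36 * C + 7 + 2)" using n by (rule mult_le_mono1)
  then have "39 + (n * (36 * C + 7 + 2) + 1 + (C * (1 + 8) + 2)) \<le> 42 + 18 * C + 36 * (C * C)"
    by (simp add: algebra_simps)
  also have "\<dots> \<le> 200 * C ^ 2" using C2 unfolding power2_eq_square by linarith
  finally have "39 + (n * (36 * C + 7 + 2) + 1 + (C * (1 + 8) + 2)) \<le> 200 * C ^ 2" .
  from runs_weaken[OF runs_Seq[OF init runs_Seq[OF loop query]] this]
  show ?thesis by (simp only: ask_def input C_def)
qed

text \<open>\<open>Rem\<close> and \<open>Slack\<close> add up to \<open>C\<close> before and after.
  Emptying \<open>Rem\<close> brings \<open>Slack\<close> to \<open>C\<close>, so the last loop can
  move at most \<open>C\<close> units back: the clamp above. The truncated decrements of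
  \<open>Twice\<close> are the clamp below.\<close>

definition bit_step :: com where
  "bit_step = Op (Mv 1 Right) ;; Loop Rem (Op (Inc Slack) ;; Add Twice 2) ;;
     Cond (Rd 1 (Bit True)) Skip (For Den Spare (Op (Dec Twice))) ;; Loop Twice (Op (Tr Slack Rem))"

lemma runs_bit_step:
  assumes f: "f Twice = 0" "f Spare = 0" "f Rem = residue d C q j i" "f Slack = C - f Rem"
      "f Den = q" "q \<le> C"
    and \<rho>: "\<rho> 1 = (c, int i + 1)" "c (int i + 2) = Bit True \<longleftrightarrow> odd \<lfloor>d * 2 ^ Suc i\<rfloor>"
  shows "runs bit_step (\<rho>, f) (\<rho>(1 := (c, int i + 2)),
    f(Rem := residue d C q j (Suc i), Slack := C - residue d C q j (Suc i))) (23 * C + 8)"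
proof -
  have r: "f Rem \<le> C" by (simp add: f residue_def nat_le_iff)
  let ?\<rho> = "\<rho>(1 := (c, int i + 2))"
  define f1 where "f1 = f(Rem := 0, Slack := C, Twice := 2 * f Rem)"
  define w where "w = 2 * f Rem - (if odd \<lfloor>d * 2 ^ Suc i\<rfloor> then 0 else q)"
  define f2 where "f2 = f(Rem := 0, Slack := C, Twice := w)"
  have 1: "runs (Loop Rem (Op (Inc Slack) ;; Add Twice 2)) (?\<rho>, f) (?\<rho>, f1) (C * 6 + 1)"
    using r f by (intro runs_cong[OF runs_Loop_Inc_Add]) (auto simp: f1_def fun_eq_iff)
  have "runs (Cond (Rd 1 (Bit True)) Skip (For Den Spare (Op (Dec Twice)))) (?\<rho>, f1) (?\<rho>, f2) (q * 9 + 2 + 2)"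
  proof (rule runs_Cond)
    assume "test_sem (Rd 1 (Bit True)) (?\<rho>, f1)"
    then have "f1 = f2" using \<rho> by (auto simp: f1_def f2_def w_def)
    then show "runs Skip (?\<rho>, f1) (?\<rho>, f2) (q * 9 + 2)" using runs_weaken[OF runs_Skip] by auto
  next
    assume "\<not> test_sem (Rd 1 (Bit True)) (?\<rho>, f1)"
    then show "runs (For Den Spare (Op (Dec Twice))) (?\<rho>, f1) (?\<rho>, f2) (q * 9 + 2)"
      using \<rho> f by (intro runs_cong[OF runs_For_Dec]) (auto simp: f1_def f2_def w_def fun_eq_iff)
  qed
  moreover have "runs (Loop Twice (Op (Tr Slack Rem))) (?\<rho>, f2) (?\<rho>,
      f(Rem := residue d C q j (Suc i), Slack := C - residue d C q j (Suc i))) (w * 4 + 1)"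
    using f r by (intro runs_cong[OF runs_Loop_Tr])
      (auto simp: f2_def w_def residue_Suc fun_eq_iff)
  ultimately show ?thesis
    unfolding bit_step_def
  proof (intro runs_cong[OF runs_Seq[OF runs_Mv runs_Seq[OF _ runs_Seq]]])
    show "runs (Loop Rem (Op (Inc Slack) ;; Add Twice 2))
        (\<rho>(1 := act_tape (read_tape (\<rho> 1), Right) (\<rho> 1)), f) (?\<rho>, f1) (C * 6 + 1)"
      using 1 by (simp add: \<rho> add.commute del: One_nat_def)
    show "1 + (C * 6 + 1 + (q * 9 + 2 + 2 + (w * 4 + 1))) \<le> 23 * C + 8"
      using r f(6) by (auto simp: w_def)
  qed auto
qed

subsection \<open>The main loop\<close>

text \<open>Everything except \<open>Acc\<close> is restored, including the head on the answer, so
  that the same digits can be read again for the next p. The last line gives \<open>q\<close> units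
  of \<open>Rem\<close> back to \<open>Slack\<close>, which is the truncated subtraction in
  \<open>piece\<close>, and adds the rest to \<open>Acc\<close>.\<close>

definition pass :: com where
  "pass =
     (For Off Spare (Op (Tr Slack Rem)) ;;
      Cond (Rd 1 (Bit True)) (For Den Spare (Op (Tr Slack Rem))) Skip) ;;
     (For Den Spare (Op (Inc Cnt)) ;; For Prec Spare (Op (Inc Cnt))) ;;
     Op (Mv 1 Right) ;; For Cnt Done bit_step ;; Loop Cnt (Op (Mv 1 Left)) ;; Op (Mv 1 Left) ;;
     (For Den Spare (Op (Tr Rem Slack)) ;; Loop Rem (Op (Inc Slack) ;; Add Acc 1))"

lemma residue_le: "residue d C q j i \<le> C"
  by (simp add: residue_def nat_le_iff)

lemma runs_pass:
  assumes f: "f Den = q" "f Off = j" "f Prec = m" "f Slack = 2 ^ m"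
      "f Rem = 0" "f Twice = 0" "f Cnt = 0" "f Done = 0" "f Spare = 0"
    and c: "\<rho> 1 = (c, 0)" "c 0 = Bit (odd \<lfloor>d\<rfloor>)"
      "\<And>i. c (int i + 2) = Bit True \<longleftrightarrow> odd \<lfloor>d * 2 ^ Suc i\<rfloor>"
    and d: "0 \<le> d" "d < 2" and j: "j \<le> q" and q: "2 * q \<le> 2 ^ m" "q + m \<le> 2 ^ m"
  shows "runs pass (\<rho>, f) (\<rho>, f(Acc := f Acc + piece d m q j)) (200 * (2 ^ m) ^ 2)"
proof -
  define C :: nat where "C = 2 ^ m"
  define L where "L = q + m"
  define r where "r i = residue d C q j i" for i
  \<comment> \<open>After \<open>i\<close> fractional digits the head is at cell
    \<open>i + 1\<close>; for \<open>i = 0\<close> this is the binary point, because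
    \<open>bit_step\<close> moves before it reads.\<close>
  define \<rho>1 where "\<rho>1 i = \<rho>(1 := (c, int i + 1))" for i :: nat
  have r: "r i \<le> C" for i by (simp add: r_def residue_le)
  have r0: "r 0 = j + (if odd \<lfloor>d\<rfloor> then q else 0)"
    using residue_0[OF d j] q by (simp add: r_def C_def)
  define g where "g i = f(Rem := r i, Slack := C - r i)" for i
  have "runs (For Off Spare (Op (Tr Slack Rem))) (\<rho>, f) (\<rho>, f(Rem := j, Slack := C - j)) (j * 9 + 2)"
    using f j q by (intro runs_cong[OF runs_For_Tr]) (auto simp: C_def fun_eq_iff)
  moreover have "runs (Cond (Rd 1 (Bit True)) (For Den Spare (Op (Tr Slack Rem))) Skip)
      (\<rho>, f(Rem := j, Slack := C - j)) (\<rho>, g 0) (q * 9 + 2 + 2)"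
  proof (rule runs_Cond)
    assume "test_sem (Rd 1 (Bit True)) (\<rho>, f(Rem := j, Slack := C - j))"
    then have "r 0 = j + q" using c r0 by (simp split: if_splits)
    then show "runs (For Den Spare (Op (Tr Slack Rem)))
        (\<rho>, f(Rem := j, Slack := C - j)) (\<rho>, g 0) (q * 9 + 2)"
      using f j q by (intro runs_cong[OF runs_For_Tr]) (auto simp: C_def g_def fun_eq_iff)
  next
    assume "\<not> test_sem (Rd 1 (Bit True)) (\<rho>, f(Rem := j, Slack := C - j))"
    then have "r 0 = j" using c r0 by simp
    then show "runs Skip (\<rho>, f(Rem := j, Slack := C - j)) (\<rho>, g 0) (q * 9 + 2)"
      using runs_weaken[OF runs_Skip] by (auto simp: g_def)
  qed
  ultimately have 1: "runs (For Off Spare (Op (Tr Slack Rem)) ;;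
      Cond (Rd 1 (Bit True)) (For Den Spare (Op (Tr Slack Rem))) Skip) (\<rho>, f) (\<rho>, g 0)
      (j * 9 + 2 + (q * 9 + 2 + 2))"
    by (rule runs_Seq)
  have 2: "runs (For Den Spare (Op (Inc Cnt)) ;; For Prec Spare (Op (Inc Cnt)))
      (\<rho>, g 0) (\<rho>, (g 0)(Cnt := L)) (q * 9 + 2 + (m * 9 + 2))"
    using f by (intro runs_cong[OF runs_Seq[OF runs_For_Inc runs_For_Inc]])
      (auto simp: g_def L_def fun_eq_iff)
  have 3: "runs (Op (Mv 1 Right)) (\<rho>, (g 0)(Cnt := L)) (\<rho>1 0, (g 0)(Cnt := L)) 1"
    using c(1) by (intro runs_cong[OF runs_Mv]) (auto simp: \<rho>1_def)
  have 4: "runs (For Cnt Done bit_step) (\<rho>1 0, (g 0)(Cnt := L)) (\<rho>1 L, (g L)(Cnt := L))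
      (L * (23 * C + 8 + 8) + 2)"
  proof (rule runs_cong_start[OF runs_For[where \<rho> = \<rho>1 and g = g and v = L and t = "23 * C + 8"]])
    fix k assume "k < L"
    show "runs bit_step (\<rho>1 k, (g k)(Cnt := L - Suc k, Done := k))
        (\<rho>1 (Suc k), (g (Suc k))(Cnt := L - Suc k, Done := k)) (23 * C + 8)"
      by (rule runs_cong[OF runs_bit_step[where c = c and i = k and C = C and q = q and j = j and d = d]])
        (use f q c in \<open>auto simp: g_def r_def \<rho>1_def C_def fun_eq_iff simp del: power_Suc\<close>)
  qed (use f in \<open>auto simp: g_def fun_eq_iff\<close>)
  have 5: "runs (Loop Cnt (Op (Mv 1 Left))) (\<rho>1 L, (g L)(Cnt := L)) (\<rho>1 0, g L) (L * (1 + 3) + 1)"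
  proof (rule runs_cong_start[OF runs_Loop[where \<rho> = "\<lambda>k. \<rho>1 (L - k)" and g = "\<lambda>_. g L" and v = L and t = 1]])
    fix k assume "k < L"
    then show "runs (Op (Mv 1 Left)) (\<rho>1 (L - k), (g L)(Cnt := L - Suc k))
        (\<rho>1 (L - Suc k), (g L)(Cnt := L - Suc k)) 1"
      by (intro runs_cong[OF runs_Mv]) (auto simp: \<rho>1_def fun_eq_iff)
  qed (use f in \<open>auto simp: g_def fun_eq_iff\<close>)
  have 6: "runs (Op (Mv 1 Left)) (\<rho>1 0, g L) (\<rho>, g L) 1"
    using c(1) by (intro runs_cong[OF runs_Mv]) (auto simp: \<rho>1_def)
  have 7: "runs (For Den Spare (Op (Tr Rem Slack)) ;; Loop Rem (Op (Inc Slack) ;; Add Acc 1))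
      (\<rho>, g L) (\<rho>, f(Acc := f Acc + piece d m q j)) (q * 9 + 2 + (C * 5 + 1))"
  proof (rule runs_cong[OF runs_Seq[OF runs_For_Tr runs_weaken[OF runs_Loop_Inc_Add]]])
    have "piece d m q j = r L - q" by (simp add: piece_def r_def C_def L_def)
    \<comment> \<open>\<open>Slack\<close> regains \<open>C\<close> whether or not the residue
      reaches \<open>q\<close>.\<close>
    moreover have "C - r L + min q (r L) + (r L - q) = C" using r[of L] by simp
    ultimately show "(\<rho>, ((g L)(Rem := g L Rem - g L Den, Slack := g L Slack + min (g L Den) (g L Rem)))
        (Rem := 0,
         Slack := ((g L)(Rem := g L Rem - g L Den, Slack := g L Slack + min (g L Den) (g L Rem))) Slack +
           ((g L)(Rem := g L Rem - g L Den, Slack := g L Slack + min (g L Den) (g L Rem))) Rem,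
         Acc := ((g L)(Rem := g L Rem - g L Den, Slack := g L Slack + min (g L Den) (g L Rem))) Acc +
           1 * ((g L)(Rem := g L Rem - g L Den, Slack := g L Slack + min (g L Den) (g L Rem))) Rem)) =
      (\<rho>, f(Acc := f Acc + piece d m q j))"
      using f by (auto simp: g_def C_def fun_eq_iff)
    show "((g L)(Rem := g L Rem - g L Den, Slack := g L Slack + min (g L Den) (g L Rem))) Rem * (1 + 4) + 1
        \<le> C * 5 + 1"
      using r[of L] by (simp add: g_def)
  qed (use f in \<open>auto simp: g_def\<close>)
  let ?t = "j * 9 + 2 + (q * 9 + 2 + 2) + (q * 9 + 2 + (m * 9 + 2) + (1 + (L * (23 * C + 8 + 8) + 2 +
      (L * (1 + 3) + 1 + (1 + (q * 9 + 2 + (C * 5 + 1)))))))"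
  have "L * (23 * C + 8 + 8) \<le> C * (23 * C + 8 + 8)" using q by (intro mult_le_mono1) (simp add: L_def C_def)
  then have "?t \<le> 23 * (C * C) + 100 * C + 20"
    using q j by (simp add: algebra_simps L_def flip: C_def)
  moreover have "C \<le> C * C" "1 \<le> C" by (auto simp: C_def)
  ultimately have "?t \<le> 200 * C ^ 2" unfolding power2_eq_square by linarith
  from runs_weaken[OF runs_Seq[OF 1 runs_Seq[OF 2 runs_Seq[OF 3 runs_Seq[OF 4 runs_Seq[OF 5
        runs_Seq[OF 6 7]]]]]] this]
  show ?thesis by (simp only: pass_def C_def)
qed

section \<open>Division by repeated subtraction\<close>

definition cdiv_com :: "reg \<Rightarrow> reg \<Rightarrow> com" where
  "cdiv_com a b = While (NZ a) (For Den Spare (Op (Dec a)) ;; Op (Inc b))"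

lemma cdiv_step:
  assumes "a \<noteq> 0" "q \<ge> 1"
  shows "cdiv a q = Suc (cdiv (a - q) q)"
proof -
  have "cdiv a q = Suc ((a + q - 1 - q) div q)"
    unfolding cdiv_def using assms by (intro le_div_geq) auto
  also have "(a + q - 1 - q) div q = cdiv (a - q) q"
    using assms by (cases "a \<le> q") (auto simp: cdiv_def)
  finally show ?thesis .
qed

lemma cdiv_0: "q \<ge> 1 \<Longrightarrow> cdiv 0 q = 0"
  by (simp add: cdiv_def)

lemma runs_cdiv_com:
  assumes "distinct [a, b, Den, Spare]" "f Spare = 0" "f Den \<ge> 1"
  shows "runs (cdiv_com a b) (\<rho>, f) (\<rho>, f(a := 0, b := f b + cdiv (f a) (f Den)))
    (f a * (9 * f Den + 5) + 1)"
  using assms(2,3)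
proof (induction "f a" arbitrary: f rule: less_induct)
  case less
  show ?case
  proof (cases "f a = 0")
    case True
    then have "f(a := 0, b := f b + cdiv (f a) (f Den)) = f"
      using less.prems assms(1) by (auto simp: cdiv_0 fun_eq_iff)
    then show ?thesis unfolding cdiv_com_def using runs_weaken[OF runs_While_False[of "NZ a"]] True by simp
  next
    case False
    define f' where "f' = f(a := f a - f Den, b := Suc (f b))"
    have "runs (For Den Spare (Op (Dec a)) ;; Op (Inc b)) (\<rho>, f) (\<rho>, f') (f Den * 9 + 2 + 1)"
      using less.prems assms(1)
      by (intro runs_cong[OF runs_Seq[OF runs_For_Dec runs_Inc]]) (auto simp: f'_def fun_eq_iff)
    moreover have "runs (cdiv_com a b) (\<rho>, f') (\<rho>, f'(a := 0, b := f' b + cdiv (f' a) (f' Den)))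
        (f' a * (9 * f' Den + 5) + 1)"
      using less.prems assms(1) False by (intro less.hyps) (auto simp: f'_def)
    ultimately have "runs (cdiv_com a b) (\<rho>, f) (\<rho>, f'(a := 0, b := f' b + cdiv (f' a) (f' Den)))
        (2 + (f Den * 9 + 2 + 1) + (f' a * (9 * f' Den + 5) + 1))"
      using False unfolding cdiv_com_def by (intro runs_While_True) auto
    then show ?thesis
    proof (rule runs_cong)
      show "(\<rho>, f'(a := 0, b := f' b + cdiv (f' a) (f' Den))) =
          (\<rho>, f(a := 0, b := f b + cdiv (f a) (f Den)))"
        using False less.prems assms(1) cdiv_step[of "f a" "f Den"] by (auto simp: f'_def fun_eq_iff)
      \<comment> \<open>A round removes at least one unit, as the divisor is positive; the time
        bound therefore allows for \<open>f a\<close> rounds.\<close>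
      have "Suc (f a - f Den) \<le> f a" using False less.prems by simp
      then have "Suc (f a - f Den) * (9 * f Den + 5) \<le> f a * (9 * f Den + 5)" by (rule mult_le_mono1)
      then show "2 + (f Den * 9 + 2 + 1) + (f' a * (9 * f' Den + 5) + 1) \<le> f a * (9 * f Den + 5) + 1"
        using assms(1) by (auto simp: f'_def)
    qed
  qed
qed

text \<open>\<open>Off\<close> runs from \<open>q\<close> down to 1, that is, p from 0 up to
  \<open>q - 1\<close>. The quotients alternate between \<open>Acc\<close> and \<open>Quo\<close>,
  and the third is added directly to \<open>Tot\<close>.\<close>

definition level_com :: com where
  "level_com = For Den Spare (Op (Inc Off)) ;; While (NZ Off) (pass ;; Op (Dec Off)) ;;
     cdiv_com Acc Quo ;; cdiv_com Quo Acc ;; cdiv_com Acc Tot ;; Op (Dec Den)"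

lemma cdiv_le: "q \<ge> 1 \<Longrightarrow> cdiv a q \<le> a"
proof (induction a rule: less_induct)
  case (less a)
  show ?case
  proof (cases "a = 0")
    case False
    then have "cdiv (a - q) q \<le> a - q" using less by auto
    then show ?thesis using False less.prems cdiv_step[of a q] by simp
  qed (use less.prems cdiv_0 in simp)
qed

lemma piece_le: "piece d m q j \<le> 2 ^ m"
  using residue_le[of d "2 ^ m" q j "q + m"] by (simp add: piece_def)

lemma runs_level:
  assumes f: "f Den = q" "f Prec = m" "f Slack = 2 ^ m" "f Rem = 0" "f Twice = 0" "f Cnt = 0"
      "f Done = 0" "f Spare = 0" "f Off = 0" "f Acc = 0" "f Quo = 0"
    and c: "\<rho> 1 = (c, 0)" "c 0 = Bit (odd \<lfloor>d\<rfloor>)"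
      "\<And>i. c (int i + 2) = Bit True \<longleftrightarrow> odd \<lfloor>d * 2 ^ Suc i\<rfloor>"
    and d: "0 \<le> d" "d < 2" and q: "2 * q \<le> 2 ^ m" "q + m \<le> 2 ^ m" "q \<ge> 1"
  shows "runs level_com (\<rho>, f) (\<rho>, f(Tot := f Tot + level d m q, Den := q - 1)) (300 * (2 ^ m) ^ 3)"
proof -
  define C :: nat where "C = 2 ^ m"
  define s where "s k = (\<Sum>p<k. piece d m q (q - p))" for k
  define g where "g k = f(Acc := s k)" for k
  have 1: "runs (For Den Spare (Op (Inc Off))) (\<rho>, f) (\<rho>, f(Off := q)) (q * 9 + 2)"
    using f by (intro runs_cong[OF runs_For_Inc]) auto
  have 2: "runs (While (NZ Off) (pass ;; Op (Dec Off))) (\<rho>, f(Off := q)) (\<rho>, g q)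
      (q * (200 * C ^ 2 + 1 + 2) + 1)"
  proof (rule runs_cong_start[OF runs_countdown[where \<rho> = "\<lambda>_. \<rho>" and g = g and v = q and t = "200 * C ^ 2 + 1"]])
    fix k assume "k < q"
    have "runs pass (\<rho>, (g k)(Off := q - k)) (\<rho>, (g (Suc k))(Off := q - k)) (200 * C ^ 2)"
      by (rule runs_cong[OF runs_pass[where c = c and d = d and q = q and m = m and j = "q - k"]])
        (use f c d q in \<open>auto simp: g_def s_def C_def fun_eq_iff simp del: power_Suc\<close>)
    from runs_Seq[OF this runs_Dec]
    show "runs (pass ;; Op (Dec Off)) (\<rho>, (g k)(Off := q - k)) (\<rho>, (g (Suc k))(Off := q - Suc k))
        (200 * C ^ 2 + 1)"
      by (rule runs_cong) auto
  qed (use f in \<open>auto simp: g_def s_def fun_eq_iff\<close>)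
  let ?a = "s q" let ?b = "cdiv ?a q" let ?c = "cdiv ?b q"
  \<comment> \<open>The sum over a level may exceed \<open>C\<close> but not \<open>C ^ 2\<close>,
    so the divisions cost of the order of \<open>C ^ 3\<close>, as do the \<open>q\<close> passes
    together.\<close>
  have "s q \<le> (\<Sum>p<q. C)" unfolding s_def C_def by (intro sum_mono piece_le)
  also have "\<dots> \<le> C * C" using q by (simp add: C_def)
  finally have "?a \<le> C * C" .
  moreover from this have "?b \<le> C * C" by (meson cdiv_le[OF q(3)] order_trans)
  moreover from this have "?c \<le> C * C" by (meson cdiv_le[OF q(3)] order_trans)
  ultimately have t: "x * (9 * q + 5) + 1 \<le> C * C * (9 * C + 5) + 1" if "x \<in> {?a, ?b, ?c}" for x
    using q that unfolding C_def by (intro add_mono mult_le_mono) auto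
  have 3: "runs (cdiv_com Acc Quo) (\<rho>, g q) (\<rho>, f(Quo := ?b)) (C * C * (9 * C + 5) + 1)"
    using f q t[of ?a] by (intro runs_cong[OF runs_cdiv_com]) (auto simp: g_def fun_eq_iff)
  have 4: "runs (cdiv_com Quo Acc) (\<rho>, f(Quo := ?b)) (\<rho>, f(Acc := ?c)) (C * C * (9 * C + 5) + 1)"
    using f q t[of ?b] by (intro runs_cong[OF runs_cdiv_com]) (auto simp: fun_eq_iff)
  have 5: "runs (cdiv_com Acc Tot) (\<rho>, f(Acc := ?c)) (\<rho>, f(Tot := f Tot + level d m q))
      (C * C * (9 * C + 5) + 1)"
    using f q t[of ?c] by (intro runs_cong[OF runs_cdiv_com]) (auto simp: level_def s_def fun_eq_iff)
  have 6: "runs (Op (Dec Den)) (\<rho>, f(Tot := f Tot + level d m q))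
      (\<rho>, f(Tot := f Tot + level d m q, Den := q - 1)) 1"
    using f by (intro runs_cong[OF runs_Dec]) auto
  let ?t = "q * 9 + 2 + (q * (200 * C ^ 2 + 1 + 2) + 1 + (C * C * (9 * C + 5) + 1 +
    (C * C * (9 * C + 5) + 1 + (C * C * (9 * C + 5) + 1 + 1))))"
  have "q * 9 + 2 + (q * (200 * C ^ 2 + 1 + 2) + 1) \<le> C * 9 + 2 + (C * (200 * C ^ 2 + 1 + 2) + 1)"
    using q unfolding C_def by (intro add_mono mult_le_mono) auto
  then have "?t \<le> 227 * (C * C * C) + 15 * (C * C) + 12 * C + 7"
    by (simp add: power2_eq_square algebra_simps)
  moreover have "1 \<le> C" "C \<le> C * C" "C * C \<le> C * C * C" by (auto simp: C_def)
  ultimately have "?t \<le> 300 * C ^ 3" unfolding power3_eq_cube by linarith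
  from runs_weaken[OF runs_Seq[OF 1 runs_Seq[OF 2 runs_Seq[OF 3 runs_Seq[OF 4 runs_Seq[OF 5 6]]]]] this]
  show ?thesis by (simp only: level_com_def C_def)
qed

lemma runs_levels:
  assumes f: "f Den = N" "f Prec = m" "f Slack = 2 ^ m" "f Rem = 0" "f Twice = 0" "f Cnt = 0"
      "f Done = 0" "f Spare = 0" "f Off = 0" "f Acc = 0" "f Quo = 0" "f Tot = 0"
    and c: "\<rho> 1 = (c, 0)" "c 0 = Bit (odd \<lfloor>d\<rfloor>)"
      "\<And>i. c (int i + 2) = Bit True \<longleftrightarrow> odd \<lfloor>d * 2 ^ Suc i\<rfloor>"
    and d: "0 \<le> d" "d < 2" and N: "2 * N \<le> 2 ^ m" "N + m \<le> 2 ^ m"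
  shows "runs (While (NZ Den) level_com) (\<rho>, f) (\<rho>, f(Tot := approx d m N, Den := 0))
    (400 * (2 ^ m) ^ 4)"
proof -
  define C :: nat where "C = 2 ^ m"
  define g where "g k = f(Tot := \<Sum>i<k. level d m (N - i))" for k
  have "N * (300 * C ^ 3 + 2) + 1 \<le> C * (300 * C ^ 3 + 2) + 1"
    using N unfolding C_def by (intro add_mono mult_le_mono1) auto
  also have "\<dots> = 300 * (C * C * (C * C)) + 2 * C + 1"
    by (simp add: power3_eq_cube algebra_simps)
  also have "\<dots> \<le> 400 * (C * C * (C * C))"
  proof -
    have "1 \<le> C" "C \<le> C * C" "C * C \<le> C * C * (C * C)" by (auto simp: C_def)
    then show ?thesis by linarith
  qed
  also have "\<dots> = 400 * C ^ 4" by (simp add: power4_eq_xxxx mult.assoc)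
  finally have t: "N * (300 * C ^ 3 + 2) + 1 \<le> 400 * (2 ^ m) ^ 4" by (simp add: C_def)
  show ?thesis
  proof (rule runs_cong_start[OF runs_countdown[where \<rho> = "\<lambda>_. \<rho>" and g = g and v = N and t = "300 * C ^ 3"] _ _ t])
    fix k assume k: "k < N"
    show "runs level_com (\<rho>, (g k)(Den := N - k)) (\<rho>, (g (Suc k))(Den := N - Suc k)) (300 * C ^ 3)"
      by (rule runs_cong[OF runs_level[where c = c and d = d and q = "N - k" and m = m]])
        (use f c d N k in \<open>auto simp: g_def C_def fun_eq_iff simp del: power_Suc\<close>)
  qed (use f in \<open>auto simp: g_def approx_def fun_eq_iff\<close>)
qed

subsection \<open>Binary output\<close>

text \<open>Comparison by simultaneous countdown: \<open>Tot\<close> is consumed while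
  \<open>Unit\<close> drains into \<open>Acc\<close>, and the excess goes to \<open>Quo\<close>.
  \<open>Unit\<close> stays positive exactly if the digit is 0, and the remainder is then
  \<open>Acc\<close>, otherwise \<open>Quo\<close>; it is doubled back into \<open>Tot\<close> while
  \<open>Unit\<close> is refilled.\<close>

definition digit :: com where
  "digit =
     Loop Tot (Cond (NZ Unit) (Op (Tr Unit Acc)) (Op (Inc Quo))) ;;
     Cond (NZ Unit)
       (Op (Wr 2 (Bit False) Right) ;; Loop Acc (Op (Inc Unit) ;; Add Tot 2))
       (Op (Wr 2 (Bit True) Right) ;; Loop Acc (Op (Inc Unit)) ;; Loop Quo (Add Tot 2))"

text \<open>
  The remainder of \<open>v\<close> after its leading digit, of weight \<open>e\<close>, has been split off, doubled so that the
  next digit has the same weight.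
\<close>

definition shift_rest :: "nat \<Rightarrow> nat \<Rightarrow> nat" where
  "shift_rest e v = 2 * (v - (if e \<le> v then e else 0))"

lemma shift_rest_less: "v < 2 * e \<Longrightarrow> shift_rest e v < 2 * e"
  by (auto simp: shift_rest_def)

lemma runs_digit:
  assumes f: "f Tot = v" "f Unit = e" "f Acc = 0" "f Quo = 0" and v: "v < 2 * e"
    and \<rho>: "\<rho> 2 = written_tape w"
  shows "runs digit (\<rho>, f)
    (\<rho>(2 := written_tape (w @ [Bit (e \<le> v)])), f(Tot := shift_rest e v)) (30 * e + 10)"
proof -
  define g where "g k = f(Tot := 0, Unit := e - k, Acc := min k e, Quo := k - e)" for k
  have 1: "runs (Loop Tot (Cond (NZ Unit) (Op (Tr Unit Acc)) (Op (Inc Quo)))) (\<rho>, f) (\<rho>, g v)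
      (v * (1 + 2 + 3) + 1)"
  proof (rule runs_cong[OF runs_Loop_Op[where g = g and v = v and t = "1 + 2"]])
    fix k assume "k < v"
    show "runs (Cond (NZ Unit) (Op (Tr Unit Acc)) (Op (Inc Quo)))
        (\<rho>, (g k)(Tot := v - Suc k)) (\<rho>, (g (Suc k))(Tot := v - Suc k)) (1 + 2)"
    proof (rule runs_Cond)
      assume "test_sem (NZ Unit) (\<rho>, (g k)(Tot := v - Suc k))"
      then show "runs (Op (Tr Unit Acc))
          (\<rho>, (g k)(Tot := v - Suc k)) (\<rho>, (g (Suc k))(Tot := v - Suc k)) 1"
        by (intro runs_cong[OF runs_Tr]) (auto simp: g_def fun_eq_iff)
    next
      assume "\<not> test_sem (NZ Unit) (\<rho>, (g k)(Tot := v - Suc k))"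
      then show "runs (Op (Inc Quo))
          (\<rho>, (g k)(Tot := v - Suc k)) (\<rho>, (g (Suc k))(Tot := v - Suc k)) 1"
        by (intro runs_cong[OF runs_Inc]) (auto simp: g_def fun_eq_iff)
    qed
  qed (use f in \<open>auto simp: g_def fun_eq_iff\<close>)
  let ?s = "(\<rho>(2 := written_tape (w @ [Bit (e \<le> v)])), f(Tot := shift_rest e v))"
  have 2: "runs (Cond (NZ Unit)
       (Op (Wr 2 (Bit False) Right) ;; Loop Acc (Op (Inc Unit) ;; Add Tot 2))
       (Op (Wr 2 (Bit True) Right) ;; Loop Acc (Op (Inc Unit)) ;; Loop Quo (Add Tot 2)))
     (\<rho>, g v) ?s (11 * e + 3 + 2)"
  proof (rule runs_Cond)
    assume "test_sem (NZ Unit) (\<rho>, g v)"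
    then show "runs (Op (Wr 2 (Bit False) Right) ;; Loop Acc (Op (Inc Unit) ;; Add Tot 2)) (\<rho>, g v) ?s
        (11 * e + 3)"
      using f by (intro runs_cong[OF runs_Seq[OF runs_Wr runs_Loop_Inc_Add]])
        (auto simp: g_def \<rho> act_written_tape shift_rest_def fun_eq_iff)
  next
    assume "\<not> test_sem (NZ Unit) (\<rho>, g v)"
    then show "runs (Op (Wr 2 (Bit True) Right) ;; Loop Acc (Op (Inc Unit)) ;; Loop Quo (Add Tot 2))
        (\<rho>, g v) ?s (11 * e + 3)"
      using f v by (intro runs_cong[OF runs_Seq[OF runs_Wr runs_Seq[OF runs_Loop_Inc runs_Loop_Add]]])
        (auto simp: g_def \<rho> act_written_tape shift_rest_def fun_eq_iff)
  qed
  show ?thesis unfolding digit_def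
    by (rule runs_weaken[OF runs_Seq[OF 1 2]]) (use v in auto)
qed

definition msb_digits :: "nat \<Rightarrow> nat \<Rightarrow> nat \<Rightarrow> nat \<Rightarrow> bool list" where
  "msb_digits e v i k = map (\<lambda>i. e \<le> (shift_rest e ^^ i) v) [i..<k]"

text \<open>The invariant of long division, with the digits so far forming \<open>h\<close>. For
  \<open>2 * e = 2 ^ k\<close> it reads \<open>h * 2 ^ k + rest = 2 ^ k * v\<close> with the rest
  below \<open>2 ^ k\<close>, which forces \<open>h = v\<close>.\<close>

lemma horner_sum_msb_digits:
  assumes "v < 2 * e"
  shows "\<exists>h. horner_sum of_bool 2 (rev (msb_digits e v 0 k)) = real h \<and>
    h * (2 * e) + (shift_rest e ^^ k) v = 2 ^ k * v \<and> (shift_rest e ^^ k) v < 2 * e"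
proof (induction k)
  case 0
  then show ?case using assms by (auto simp: msb_digits_def intro!: exI[of _ 0])
next
  case (Suc k)
  then obtain h where h: "horner_sum of_bool 2 (rev (msb_digits e v 0 k)) = real h"
      "h * (2 * e) + (shift_rest e ^^ k) v = 2 ^ k * v" "(shift_rest e ^^ k) v < 2 * e" by blast
  define r where "r = (shift_rest e ^^ k) v"
  have "(2 * h + of_bool (e \<le> r)) * (2 * e) + shift_rest e r = 2 * (h * (2 * e) + r)"
    by (auto simp: shift_rest_def algebra_simps)
  then show ?case using h shift_rest_less
    by (intro exI[of _ "2 * h + of_bool (e \<le> r)"]) (auto simp: msb_digits_def r_def)
qed

text \<open>A total below \<open>4 * 2 ^ m\<close> has leading weight \<open>2 * 2 ^ m\<close>,
  which \<open>Unit\<close> receives from \<open>Slack\<close>, and two digits before the point;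
  \<open>represents\<close> admits leading zeros.\<close>

definition emit :: com where
  "emit = Loop Slack (Add Unit 2) ;; (digit ;; digit) ;; Op (Wr 2 Point Right) ;; Loop Prec digit"

definition output_word :: "nat \<Rightarrow> nat \<Rightarrow> symbol list" where
  "output_word m v = map Bit (msb_digits (2 ^ Suc m) v 0 2) @ [Point] @
     map Bit (msb_digits (2 ^ Suc m) v 2 (2 + m))"

lemma represents_output_word:
  assumes "v < 2 ^ (m + 2)"
  shows "represents (output_word m v) (real v / 2 ^ m)"
proof -
  define e :: nat where "e = 2 ^ Suc m"
  have e: "2 * e = 2 ^ (2 + m)" by (simp add: e_def)
  obtain h where h: "horner_sum of_bool 2 (rev (msb_digits e v 0 (2 + m))) = real h"
      "h * (2 * e) + (shift_rest e ^^ (2 + m)) v = 2 ^ (2 + m) * v" "(shift_rest e ^^ (2 + m)) v < 2 * e"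
    using horner_sum_msb_digits[of v e "2 + m"] assms e by (auto simp: add.commute)
  have "h = v"
  proof -
    define w where "w = (shift_rest e ^^ (2 + m)) v"
    have "w < 2 * e" using h(3) unfolding w_def .
    then have "(h * (2 * e) + w) div (2 * e) = h" by simp
    moreover have "2 ^ (2 + m) * v div (2 * e) = v" unfolding e by simp
    ultimately show ?thesis using h(2) unfolding w_def[symmetric] by simp
  qed
  have len: "length (msb_digits e v 2 (2 + m)) = m"
    by (simp add: msb_digits_def del: upt_Suc)
  have "msb_digits e v 0 2 @ msb_digits e v 2 (2 + m) = msb_digits e v 0 (2 + m)"
    using upt_add_eq_append[of 0 2 m] by (simp add: msb_digits_def del: upt_Suc)
  then have "real v / 2 ^ m = horner_sum of_bool 2
      (rev (msb_digits e v 0 2 @ msb_digits e v 2 (2 + m))) / 2 ^ length (msb_digits e v 2 (2 + m))"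
    using h(1) \<open>h = v\<close> by (simp only: len)
  moreover have "msb_digits e v 0 2 \<noteq> []" by (simp add: msb_digits_def)
  ultimately show ?thesis unfolding represents_def output_word_def e_def
    by (intro exI[of _ False]) auto
qed

lemma runs_emit:
  assumes f: "f Tot = v" "f Slack = 2 ^ m" "f Prec = m" "f Unit = 0" "f Acc = 0" "f Quo = 0"
    and v: "v < 2 ^ (m + 2)" and \<rho>: "\<rho> 2 = word_tape []"
  shows "\<exists>\<rho>' f'. \<rho>' 2 = written_tape (output_word m v) \<and>
    runs emit (\<rho>, f) (\<rho>', f') (400 * (2 ^ m) ^ 2)"
proof -
  define C :: nat where "C = 2 ^ m"
  define e :: nat where "e = 2 ^ Suc m"
  have e: "e = 2 * C" by (simp add: e_def C_def)
  define r where "r k = (shift_rest e ^^ k) v" for k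
  have r: "r k < 2 * e" for k
    using horner_sum_msb_digits[of v e k] v by (auto simp: r_def e_def)
  define g where "g k = f(Slack := 0, Unit := e, Tot := r k)" for k
  define out where "out w = \<rho>(2 := written_tape w)" for w
  have dig: "runs digit (out w, (g k)(Prec := l)) (out (w @ [Bit (e \<le> r k)]), (g (Suc k))(Prec := l)) (60 * C + 10)"
    for w k l
    by (rule runs_cong[OF runs_digit[where v = "r k" and e = e and w = w]])
      (use f r in \<open>auto simp: g_def out_def r_def fun_eq_iff e\<close>)
  have bits: "map Bit (msb_digits e v 0 2) = ([] @ [Bit (e \<le> r 0)]) @ [Bit (e \<le> r 1)]"
    by (simp add: msb_digits_def r_def eval_nat_numeral)
  have 1: "runs (Loop Slack (Add Unit 2)) (\<rho>, f) (out [], (g 0)(Prec := m)) (C * (2 + 3) + 1)"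
    using f by (intro runs_cong[OF runs_Loop_Add])
      (auto simp: g_def out_def r_def e C_def \<rho> written_tape_Nil fun_eq_iff)
  have 2: "runs (digit ;; digit) (out [], (g 0)(Prec := m))
      (out (map Bit (msb_digits e v 0 2)), (g 2)(Prec := m)) (60 * C + 10 + (60 * C + 10))"
    unfolding bits by (rule runs_cong[OF runs_Seq[OF dig dig]]) (auto simp: numeral_2_eq_2)
  let ?w = "\<lambda>k. map Bit (msb_digits e v 0 2) @ [Point] @ map Bit (msb_digits e v 2 (2 + k))"
  have 3: "runs (Op (Wr 2 Point Right)) (out (map Bit (msb_digits e v 0 2)), (g 2)(Prec := m))
      (out (?w 0), (g 2)(Prec := m)) 1"
    by (rule runs_cong[OF runs_Wr]) (auto simp: out_def act_written_tape msb_digits_def)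
  have 4: "runs (Loop Prec digit) (out (?w 0), (g 2)(Prec := m)) (out (?w m), (g (2 + m))(Prec := 0))
      (m * (60 * C + 10 + 3) + 1)"
  proof (rule runs_cong_start[OF runs_Loop[where \<rho> = "\<lambda>k. out (?w k)" and g = "\<lambda>k. g (2 + k)"
          and v = m and t = "60 * C + 10"]])
    fix k
    show "runs digit (out (?w k), (g (2 + k))(Prec := m - Suc k))
        (out (?w (Suc k)), (g (2 + Suc k))(Prec := m - Suc k)) (60 * C + 10)"
      by (rule runs_cong[OF dig]) (auto simp: msb_digits_def r_def)
  qed auto
  have "m \<le> C" unfolding C_def by (rule less_imp_le[OF less_exp])
  then have "m * (60 * C + 10 + 3) \<le> C * (60 * C + 10 + 3)" by (rule mult_le_mono1)
  then have "C * (2 + 3) + 1 + (60 * C + 10 + (60 * C + 10) + (1 + (m * (60 * C + 10 + 3) + 1))) \<le>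
      60 * (C * C) + 138 * C + 23"
    by (simp add: algebra_simps)
  moreover have "1 \<le> C" "C \<le> C * C" by (auto simp: C_def)
  ultimately have "C * (2 + 3) + 1 + (60 * C + 10 + (60 * C + 10) + (1 + (m * (60 * C + 10 + 3) + 1)))
      \<le> 400 * C ^ 2"
    unfolding power2_eq_square by linarith
  from runs_weaken[OF runs_Seq[OF 1 runs_Seq[OF 2 runs_Seq[OF 3 4]]] this]
  have "runs emit (\<rho>, f) (out (?w m), (g (2 + m))(Prec := 0)) (400 * (2 ^ m) ^ 2)"
    by (simp only: emit_def C_def)
  moreover have "out (?w m) 2 = written_tape (output_word m v)"
    by (simp add: out_def output_word_def e_def)
  ultimately show ?thesis by blast
qed

subsection \<open>Computability\<close>

text \<open>
  A negative answer is as good as the answer 0, for which the main loop would leave the total 0.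
\<close>

definition answer :: com where
  "answer = Cond (Rd 1 Minus) Skip (While (NZ Den) level_com) ;; emit"

lemma com_ok_Add [simp]: "com_ok (Add i k)"
  by (induction k) auto

lemma com_ok_ask: "com_ok ask"
  by (simp add: ask_def grow_def Loop_def For_def base_alphabet_def)

lemma com_ok_answer: "com_ok answer"
  by (simp add: answer_def level_com_def pass_def bit_step_def cdiv_com_def emit_def digit_def
      Loop_def For_def base_alphabet_def)

text \<open>The first inequality makes the answer to query \<open>C\<close> precise enough for the
  top level, the second keeps the initial residues unclamped. With \<open>u = 2 ^ n\<close> the
  level errors add up to 12 u / (32 u^2) = 3 / (8 u) and the tail is at most 1 / (2 u), together 7 /
  (8 u).\<close>

lemma parameters:
  fixes n :: nat
  defines "C \<equiv> 2 ^ (2 * n + 5) :: nat"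
  shows "2 ^ Suc n + (2 * n + 5) \<le> C" "2 * 2 ^ Suc n \<le> C" "32 \<le> C"
    "6 * real (2 ^ Suc n) / real C + 1 / real (2 ^ Suc n) \<le> 1 / 2 ^ n"
proof -
  define u :: nat where "u = 2 ^ n"
  have "(2::nat) ^ (2 * n) = u * u" by (simp only: u_def mult_2 power_add)
  then have C: "C = 32 * (u * u)" by (simp add: C_def power_add)
  have u: "1 \<le> u" "n < u" "u \<le> u * u" "1 \<le> u * u" by (auto simp: u_def less_exp)
  show "2 ^ Suc n + (2 * n + 5) \<le> C" "2 * 2 ^ Suc n \<le> C" "32 \<le> C"
    using u unfolding C power_Suc u_def[symmetric] by linarith+
  have "6 * (2 * real u) / (32 * (real u * real u)) + 1 / (2 * real u) = 7 / 8 * (1 / real u)"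
    using u by (simp add: field_simps)
  also have "\<dots> \<le> 1 / real u" using u by (simp add: field_simps)
  finally show "6 * real (2 ^ Suc n) / real C + 1 / real (2 ^ Suc n) \<le> 1 / 2 ^ n"
    by (simp add: C u_def)
qed

definition output_num :: "(nat \<Rightarrow> real) \<Rightarrow> nat \<Rightarrow> nat" where
  "output_num \<phi> n = approx (max 0 (\<phi> (2 ^ (2 * n + 5)))) (2 * n + 5) (2 ^ Suc n)"

lemma output_num_error:
  assumes "0 \<le> x" "\<phi> \<in> CF x"
  shows "\<bar>real (output_num \<phi> n) / 2 ^ (2 * n + 5) - calF x\<bar> \<le> 1 / 2 ^ n"
proof -
  define C :: nat where "C = 2 ^ (2 * n + 5)"
  have "\<bar>\<phi> C - x\<bar> \<le> 1 / 2 ^ C"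
    using assms by (auto simp: CF_def binary_converges_def)
  \<comment> \<open>Raising a negative answer to 0 brings it closer to \<open>x\<close>, which is
    nonnegative.\<close>
  then have "\<bar>max 0 (\<phi> C) - x\<bar> \<le> 1 / 2 ^ C" using assms(1) by (auto simp: max_def)
  from approx_error[OF this, of "2 ^ Suc n" "2 * n + 5"] parameters[of n]
  show ?thesis by (simp add: output_num_def C_def)
qed

lemma output_num_less:
  assumes "0 \<le> x" "\<phi> \<in> CF x"
  shows "output_num \<phi> n < 2 ^ (2 * n + 5 + 2)"
proof -
  have "(1::real) / 2 ^ n \<le> 1" by simp
  then have "real (output_num \<phi> n) / 2 ^ (2 * n + 5) < 4"
    using output_num_error[OF assms, of n] calF_le_2[of x] by linarith
  then have "real (output_num \<phi> n) < 2 ^ (2 * n + 5 + 2)"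
    by (simp add: divide_less_eq power_add)
  then show ?thesis by (metis of_nat_less_iff of_nat_numeral of_nat_power)
qed

lemma runs_answer:
  assumes x: "x \<in> {0..1}" and \<phi>: "\<phi> \<in> CF x"
  shows "\<exists>\<rho> f. \<rho> 2 = written_tape (output_word (2 * n + 5) (output_num \<phi> n)) \<and>
    runs answer (answer_store \<phi> (ask_store n)) (\<rho>, f) (1000 * (2 ^ (2 * n + 5)) ^ 4)"
proof -
  define m where "m = 2 * n + 5"
  define C :: nat where "C = 2 ^ m"
  define N :: nat where "N = 2 ^ Suc n"
  define d where "d = \<phi> C"
  define c where "c = fst (word_tape (dyadic_word d))"
  obtain \<rho> f where s: "answer_store \<phi> (ask_store n) = (\<rho>, f)" by fastforce
  have \<rho>: "\<rho> 1 = (c, 0)" "\<rho> 2 = word_tape []"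
    using s by (auto simp: answer_store_def ask_store_def query_arg_written_tape c_def
        d_def C_def m_def word_tape_def simp del: One_nat_def)
  have f: "f = (\<lambda>r. 0)(Den := N, Prec := m, Slack := C)"
    using s by (auto simp: answer_store_def ask_store_def C_def m_def N_def)
  \<comment> \<open>The query argument is positive, so the answer is at most 3/2 and its integer
    part a single digit.\<close>
  have "(2::real) ^ 1 \<le> 2 ^ C"
    using parameters(3)[of n] by (intro power_increasing) (auto simp: C_def m_def)
  then have "1 / 2 ^ C \<le> (1 / 2 :: real)" by (simp add: field_simps)
  moreover have "\<bar>d - x\<bar> \<le> 1 / 2 ^ C"
    using \<phi> by (auto simp: CF_def binary_converges_def d_def)
  ultimately have "\<bar>d - x\<bar> \<le> 1 / 2" by (rule order_trans[rotated])
  then have d: "d < 2" using x unfolding atLeastAtMost_iff by linarith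
  have dy: "d \<in> dyadic_rationals" using \<phi> by (auto simp: CF_def d_def)
  define v where "v = approx (max 0 d) m N"
  \<comment> \<open>\<open>Den\<close> ends as \<open>N\<close> if the main loop is skipped and as 0
    otherwise; \<open>emit\<close> does not look at it.\<close>
  have "\<exists>f'. runs (Cond (Rd 1 Minus) Skip (While (NZ Den) level_com)) (\<rho>, f) (\<rho>, f(Tot := v, Den := f'))
      (400 * C ^ 4 + 2)"
  proof (cases "d < 0")
    case True
    then have "test_sem (Rd 1 Minus) (\<rho>, f)" "(\<rho>, f(Tot := v, Den := N)) = (\<rho>, f)"
      using \<rho> dyadic_word_Minus[of d] by (auto simp: c_def v_def approx_zero f)
    then show ?thesis
      using runs_weaken[OF runs_Skip] by (intro exI[of _ N] runs_Cond) auto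
  next
    case False
    then have "\<not> test_sem (Rd 1 Minus) (\<rho>, f)"
      using \<rho> dyadic_word_Minus[of d] by (auto simp: c_def)
    moreover have "runs (While (NZ Den) level_com) (\<rho>, f) (\<rho>, f(Tot := v, Den := 0)) (400 * C ^ 4)"
    proof (rule runs_cong[OF runs_levels[where c = c and d = d and m = m and N = N]])
      show "c 0 = Bit (odd \<lfloor>d\<rfloor>)" "\<And>i. (c (int i + 2) = Bit True) = odd \<lfloor>d * 2 ^ Suc i\<rfloor>"
        using dyadic_word_digits[OF dy] False d unfolding c_def by auto
    qed (use f \<rho> d False parameters[of n] in \<open>auto simp: C_def m_def N_def v_def max_def\<close>)
    ultimately show ?thesis by (intro exI[of _ 0] runs_Cond) auto
  qed
  then obtain f' where 1: "runs (Cond (Rd 1 Minus) Skip (While (NZ Den) level_com)) (\<rho>, f)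
      (\<rho>, f(Tot := v, Den := f')) (400 * C ^ 4 + 2)" ..
  have v: "v = output_num \<phi> n"
    by (simp add: v_def d_def C_def m_def N_def output_num_def)
  have "v < 2 ^ (m + 2)" using output_num_less[OF _ \<phi>] x unfolding v m_def by simp
  then obtain \<rho>' f'' where 2: "\<rho>' 2 = written_tape (output_word m v)"
      "runs emit (\<rho>, f(Tot := v, Den := f')) (\<rho>', f'') (400 * C ^ 2)"
    using runs_emit[where f = "f(Tot := v, Den := f')" and \<rho> = \<rho> and v = v and m = m] f \<rho>
    by (auto simp: C_def)
  have "1 \<le> C ^ 4" "C ^ 2 \<le> C ^ 4" by (auto simp: C_def intro: power_increasing)
  then have "400 * C ^ 4 + 2 + 400 * C ^ 2 \<le> 1000 * C ^ 4" by linarith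
  from runs_weaken[OF runs_Seq[OF 1 2(2)] this] 2(1) show ?thesis
    unfolding s answer_def C_def m_def v by blast
qed

lemma otm_outputs_within_machine:
  assumes c: "runs c (input_store n) s t" and d: "runs d (answer_store \<phi> s) (\<rho>, f) u"
    and w: "\<rho> 2 = written_tape w" "represents w y" and v: "t + u + 3 \<le> v"
  shows "otm_outputs_within (machine c d) \<phi> n v y"
proof -
  obtain t' u' where "t' \<le> t" "exec c (input_store n) t' s" "u' \<le> u" "exec d (answer_store \<phi> s) u' (\<rho>, f)"
    using c d unfolding runs_def by blast
  then have "(otm_step (machine c d) \<phi> ^^ v) (otm_init (machine c d) n) =
      (halt_state (machine c d), tapes_of (\<rho>, f))"
    using v by (intro machine_correct[where t = t' and u = u' and s = s]) auto
  moreover have "tapes_of (\<rho>, f) ! 2 = written_tape w" using w(1) by (simp add: tapes_of_def)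
  moreover have "Blank \<notin> set w" using w(2) by (auto simp: represents_def)
  ultimately show ?thesis
    using w(2) tape_output_written_tape unfolding otm_outputs_within_def by auto
qed

theorem theorem5: "exp_time_computable_on 0 1 calF"
  unfolding exp_time_computable_on_def
proof (intro exI[of _ "machine ask answer"] exI[of _ "[:35, 14:]"] conjI ballI)
  show "wf_otm (machine ask answer)" using com_ok_ask com_ok_answer by (rule wf_machine)
next
  fix x \<phi> assume x: "x \<in> {0..1::real}" and \<phi>: "\<phi> \<in> CF x"
  define \<psi> where "\<psi> n = real (output_num \<phi> n) / 2 ^ (2 * n + 5)" for n
  have "\<psi> n \<in> dyadic_rationals" for n
    unfolding dyadic_rationals_def \<psi>_def using of_int_of_nat_eq by (metis (mono_tags, lifting) mem_Collect_eq)
  moreover have "\<bar>\<psi> n - calF x\<bar> \<le> 1 / 2 ^ n" for n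
    using output_num_error[OF _ \<phi>] x by (simp add: \<psi>_def)
  ultimately have "\<psi> \<in> CF (calF x)" by (auto simp: CF_def binary_converges_def)
  moreover have "otm_outputs_within (machine ask answer) \<phi> n (2 ^ poly [:35, 14:] n) (\<psi> n)" for n
  proof -
    define C :: nat where "C = 2 ^ (2 * n + 5)"
    obtain \<rho> f where r: "\<rho> 2 = written_tape (output_word (2 * n + 5) (output_num \<phi> n))"
        "runs answer (answer_store \<phi> (ask_store n)) (\<rho>, f) (1000 * C ^ 4)"
      using runs_answer[OF x \<phi>] unfolding C_def by blast
    have "represents (output_word (2 * n + 5) (output_num \<phi> n)) (\<psi> n)"
      unfolding \<psi>_def using x \<phi> by (intro represents_output_word output_num_less) auto
    moreover have "200 * C ^ 2 + 1000 * C ^ 4 + 3 \<le> 2 ^ poly [:35, 14:] n"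
    proof -
      have C: "32 \<le> C" using parameters(3) by (simp add: C_def)
      then have "1 \<le> C ^ 4" "C ^ 2 \<le> C ^ 4" by (auto intro: power_increasing)
      \<comment> \<open>The coefficients add up to 1203, below \<open>32 ^ 3\<close>, and
        \<open>32 \<le> C\<close> turns this into \<open>C ^ 3\<close>. The total
        \<open>C ^ 7\<close> has exponent \<open>7 * (2 * n + 5)\<close>, the polynomial
        \<open>[:35, 14:]\<close>.\<close>
      then have "200 * C ^ 2 + 1000 * C ^ 4 + 3 \<le> 32 ^ 3 * C ^ 4" by simp
      also have "\<dots> \<le> C ^ 3 * C ^ 4" using C by (intro mult_right_mono power_mono) auto
      also have "\<dots> = 2 ^ poly [:35, 14:] n"
        by (simp add: C_def algebra_simps flip: power_add power_mult)
      finally show ?thesis .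
    qed
    ultimately show ?thesis
      using otm_outputs_within_machine[OF runs_ask r(2,1)] by (simp add: C_def)
  qed
  ultimately show "\<exists>\<psi>\<in>CF (calF x). \<forall>n. otm_outputs_within (machine ask answer) \<phi> n
      (2 ^ poly [:35, 14:] n) (\<psi> n)"
    by blast
qed

end
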